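(* Let $n>1$, $d\ge 2$ and $t$ be integers with $\gcd(t,d)=1$, $n\equiv t\pmod d$ and $n+d-nd\le t\le n$. Then, modulo $[n]_{q^2}\Phi_n(q^2)^2$, \[ \sum_{k=0}^{(n-t)/d}[2dk+t]_{q^2}[2dk+t]^2\frac{(q^{2t};q^{2d})_k^4}{(q^{2d};q^{2d})_k^4}q^{-4tk}\equiv \frac{-2[t]^2[n]_{q^2}(q^{4t};q^{2d})_{(n-t)/d}}{(1+q^{2t})(q^{2d};q^{2d})_{(n-t)/d}}q^{t-2t(n-t)/d}, \] and \[ \sum_{k=0}^{n-1}[2dk+t]_{q^2}[2dk+t]^2\frac{(q^{2t};q^{2d})_k^4}{(q^{2d};q^{2d})_k^4}q^{-4tk}\equiv \frac{-2[t]^2[n]_{q^2}(q^{4t};q^{2d})_{(n-t)/d}}{(1+q^{2t})(q^{2d};q^{2d})_{(n-t)/d}}q^{t-2t(n-t)/d}. \]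
   Context: For an indeterminate $q$, $(x;q)_k=(1-x)(1-xq)\cdots(1-xq^{k-1})$ (with $(x;q)_0=1$). For any integer $m$, $[m]=(1-q^m)/(1-q)$ and $[m]_{q^2}=(1-q^{2m})/(1-q^2)$. $\Phi_n(x)$ is the $n$-th cyclotomic polynomial, evaluated here at $x=q^2$. A congruence $A\equiv B\pmod{P(q)}$ between rational functions in $q$ means that $A-B$, written as a quotient of polynomials with denominator coprime to $P(q)$, has numerator divisible by $P(q)$. *)

theory Defs
  imports "HOL-Computational_Algebra.Computational_Algebra"
begin

definition qvar :: "rat poly fract" where
  "qvar = Fract [:0, 1:] 1"

definition qint :: "int \<Rightarrow> rat poly fract" where
  "qint m = (1 - qvar powi m) / (1 - qvar)"

definition qint2 :: "int \<Rightarrow> rat poly fract" where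
  "qint2 m = (1 - qvar powi (2 * m)) / (1 - qvar ^ 2)"

definition qpoch :: "rat poly fract \<Rightarrow> rat poly fract \<Rightarrow> nat \<Rightarrow> rat poly fract" where
  "qpoch x a k = (\<Prod>j<k. 1 - x * a ^ j)"

text \<open>Cyclotomic polynomials, via x^n - 1 = product of Phi_e over e dividing n.\<close>
function cyclo :: "nat \<Rightarrow> rat poly" where
  "cyclo n = (if n = 0 then 1 else
     (monom 1 n - 1) div (\<Prod>e\<in>{e. e dvd n \<and> e < n}. cyclo e))"
  by auto
termination
  by (relation "measure id") auto

definition qint2_poly :: "nat \<Rightarrow> rat poly" where
  "qint2_poly n = (\<Sum>j<n. monom 1 (2 * j))"

definition qcong :: "rat poly fract \<Rightarrow> rat poly fract \<Rightarrow> rat poly \<Rightarrow> bool" where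
  "qcong A B P \<longleftrightarrow> (\<exists>N D. D \<noteq> 0 \<and> coprime D P \<and> A - B = Fract N D \<and> P dvd N)"

end

theory Submission
  imports Defs "HOL-Computational_Algebra.Field_as_Ring" "HOL-Number_Theory.Cong"
begin

text \<open>
  Write \<open>Q = q^(2d)\<close>, \<open>a = q^(2t)\<close>, \<open>b = q^t\<close>, \<open>N = (n - t)/d\<close> and \<open>y = q^(2n) = a Q^N\<close>. Up to a common
  factor the summand is \<open>(1 - a Q^(2k)) (1 - b Q^k)^2 (a;Q)_k^4 / ((Q;Q)_k^4 a^(2k))\<close>. The congruence is
  checked in the localization at each irreducible factor \<open>p\<close> of \<open>[n]_{q^2}\<close>. Let \<open>m\<close> be the order of
  \<open>q^2\<close> modulo \<open>p\<close>; it divides \<open>n\<close>, and it equals \<open>n\<close> if \<open>p\<close> divides \<open>\<Phi>_n(q^2)\<close>.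

  Modulo \<open>p\<close>, the quotient \<open>(a;Q)_k/(Q;Q)_k\<close> is multiplicative along blocks of length \<open>m\<close>, and
  if \<open>s < m\<close> is determined by \<open>a Q^s \<equiv> 1\<close>, the summand vanishes at positions \<open>k > s\<close> of a block and
  is antisymmetric under \<open>k \<mapsto> s - k\<close>. So both sums vanish modulo \<open>p\<close>.

  If \<open>m = n\<close>, replace two of the four factors \<open>(a;Q)_k/(Q;Q)_k\<close> by
  \<open>(ay;Q)_k (a/y;Q)_k / ((Qy;Q)_k (Q/y;Q)_k)\<close>. This depends on \<open>y\<close> only through
  \<open>w = y + 1/y - 2 = (1 - y)^2/y\<close>, and the coefficient of \<open>w\<close> in the sum vanishes modulo \<open>p\<close> by the same
  antisymmetry, so the sum changes only by a multiple of \<open>p^3\<close>. As \<open>a/y = Q^(-N)\<close>, the deformed sum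
  terminates; it is a combination of two terminating \<open>6\<phi>5\<close> series, and its closed form differs from
  the right-hand side by a multiple of \<open>(1 - y)^3\<close>.
\<close>

subsection \<open>A very-well-poised series\<close>

text \<open>Stated over an arbitrary field, because the series identities are proved in that
  generality; on \<open>rat poly fract\<close> it coincides with \<open>qpoch\<close>.\<close>

definition qpochhammer :: "'a::field \<Rightarrow> 'a \<Rightarrow> nat \<Rightarrow> 'a" where
  "qpochhammer x Q k = (\<Prod>j<k. 1 - x * Q ^ j)"

lemma qpochhammer_0 [simp]: "qpochhammer x Q 0 = 1"
  by (simp add: qpochhammer_def)

lemma qpochhammer_Suc: "qpochhammer x Q (Suc k) = qpochhammer x Q k * (1 - x * Q ^ k)"
  by (simp add: qpochhammer_def)

lemma qpochhammer_shift: "qpochhammer x Q (Suc k) = (1 - x) * qpochhammer (x * Q) Q k"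
  unfolding qpochhammer_def by (subst prod.lessThan_Suc_shift) (simp add: mult.assoc)

lemma qpochhammer_nonzero: "(\<And>j. j < k \<Longrightarrow> x * Q ^ j \<noteq> 1) \<Longrightarrow> qpochhammer x Q k \<noteq> 0"
  by (auto simp: qpochhammer_def)

text \<open>Rogers' terminating very-well-poised \<open>6phi5\<close> sum, multiplied by
  \<open>1 - a\<close>. It follows by induction on \<open>N\<close> from a first-order recurrence in
  \<open>N\<close>, proved by telescoping. The inequalities on \<open>Q\<close>, \<open>a\<close>,
  \<open>b\<close>, \<open>c\<close> keep all denominators nonzero.\<close>

lemma rogers_6phi5:
  fixes a b c Q :: "'a::field"
  assumes nz: "Q \<noteq> 0" "a \<noteq> 0" "b \<noteq> 0" "c \<noteq> 0"
    and Q: "\<And>j. Q ^ Suc j \<noteq> 1"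
    and a: "\<And>j. a * Q ^ Suc j \<noteq> 1"
    and b: "\<And>j. a * Q ^ Suc j \<noteq> b"
    and c: "\<And>j. a * Q ^ Suc j \<noteq> c"
  shows "(\<Sum>k\<le>N. (1 - a * Q ^ (2*k)) * (qpochhammer a Q k * qpochhammer b Q k * qpochhammer c Q k
             * qpochhammer (1 / Q ^ N) Q k)
           / (qpochhammer Q Q k * qpochhammer (a*Q/b) Q k * qpochhammer (a*Q/c) Q k
             * qpochhammer (a * Q ^ Suc N) Q k) * (a * Q ^ Suc N / (b*c)) ^ k)
       = (1 - a) * qpochhammer (a*Q) Q N * qpochhammer (a*Q/(b*c)) Q N
           / (qpochhammer (a*Q/b) Q N * qpochhammer (a*Q/c) Q N)" (is "?S N = ?R N")
proof -
  define T where "T N k = (1 - a * Q ^ (2*k)) * (qpochhammer a Q k * qpochhammer b Q k * qpochhammer c Q k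
             * qpochhammer (1 / Q ^ N) Q k)
           / (qpochhammer Q Q k * qpochhammer (a*Q/b) Q k * qpochhammer (a*Q/c) Q k
             * qpochhammer (a * Q ^ Suc N) Q k) * (a * Q ^ Suc N / (b*c)) ^ k" for N k
  have Qnz: "1 - Q * Q ^ j \<noteq> 0" for j using Q[of j] by simp
  have anz: "1 - a * Q * Q ^ j \<noteq> 0" for j using a[of j] by (simp add: mult.assoc)
  have bnz: "1 - a * Q / b * Q ^ j \<noteq> 0" for j using b[of j] nz by (auto simp: field_simps)
  have cnz: "1 - a * Q / c * Q ^ j \<noteq> 0" for j using c[of j] nz by (auto simp: field_simps)
  \<comment> \<open>The factors on the two sides are those by which \<open>?R (Suc N)\<close> and
    \<open>?R N\<close> differ, so this recurrence is the induction step.\<close>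
  have step: "(1 - a*Q/b * Q^N) * (1 - a*Q/c * Q^N) * (\<Sum>k\<le>Suc N. T (Suc N) k)
      = (1 - a*Q*Q^N) * (1 - a*Q/(b*c) * Q^N) * (\<Sum>k\<le>N. T N k)" for N
  proof -
    define M where "M = Q ^ N"
    define z where "z = a*Q*M/(b*c)"
    have M: "M \<noteq> 0" "Q * M \<noteq> 1" "a * Q * M \<noteq> 1"
      using nz Q[of N] anz[of N] by (auto simp: M_def)
    \<comment> \<open>WZ pair: \<open>h\<close> is the common factor of \<open>T N\<close> and \<open>T (Suc N)\<close>, and \<open>G\<close> certifies the recurrence in \<open>N\<close>.\<close>
    define h where "h k = qpochhammer a Q k * qpochhammer b Q k * qpochhammer c Q k * qpochhammer (1/(Q*M)) Q k * z ^ k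
       / (qpochhammer Q Q k * qpochhammer (a*Q/b) Q k * qpochhammer (a*Q/c) Q k * qpochhammer (a*Q*M) Q (Suc k))" for k
    define G where "G k = h k * ((1 - Q^k) * (1 - a * Q^k/b) * (1 - a*Q^k/c) * (1 - a*Q*M*Q^k))" for k
    have anz': "1 - a * Q * M * Q ^ j \<noteq> 0" for j
      using anz[of "N + j"] by (simp add: M_def power_add mult_ac)
    have dens: "qpochhammer Q Q k \<noteq> 0" "qpochhammer (a*Q/b) Q k \<noteq> 0" "qpochhammer (a*Q/c) Q k \<noteq> 0"
       "qpochhammer (a*Q*M) Q k \<noteq> 0" for k
      using Qnz bnz cnz anz' by (auto intro!: qpochhammer_nonzero)
    have T1: "T (Suc N) k = (1 - a*Q*M) * h k * (1 - a * Q^k * Q^k) * Q^k" for k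
    proof -
      have "qpochhammer (a * Q ^ Suc (Suc N)) Q k = qpochhammer (a*Q*M) Q (Suc k) / (1 - a*Q*M)"
        using M by (simp add: qpochhammer_shift M_def mult_ac)
      then show ?thesis
        unfolding T_def h_def z_def M_def
        by (simp add: power_mult_distrib power_divide mult_ac power_mult power2_eq_square power_even_eq)
    qed
    have T0: "(1 - 1/(Q*M)) * T N k = h k * (1 - a * Q^k * Q^k) * (1 - Q^k/(Q*M)) * (1 - a*Q*M*Q^k)" for k
    proof -
      have e1: "(1 - 1/(Q*M)) * qpochhammer (1 / M) Q k = qpochhammer (1/(Q*M)) Q k * (1 - Q^k/(Q*M))"
        using qpochhammer_shift[of "1/(Q*M)" Q k] nz by (simp add: qpochhammer_Suc)
      have e2: "qpochhammer (a * Q * M) Q k = qpochhammer (a*Q*M) Q (Suc k) / (1 - a*Q*M*Q^k)"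
        using anz'[of k] by (simp add: qpochhammer_Suc)
      have e3: "Q ^ (2*k) = Q^k * Q^k" by (simp add: mult_2 power_add)
      have e4: "T N k = (1 - a * (Q^k*Q^k)) * (qpochhammer a Q k * qpochhammer b Q k * qpochhammer c Q k
             * qpochhammer (1 / M) Q k)
           / (qpochhammer Q Q k * qpochhammer (a*Q/b) Q k * qpochhammer (a*Q/c) Q k
             * qpochhammer (a * Q * M) Q k) * z ^ k"
        unfolding T_def e3 z_def M_def by (simp add: mult_ac)
      have "(1 - 1/(Q*M)) * T N k = (1 - a * (Q^k*Q^k)) * (qpochhammer a Q k * qpochhammer b Q k * qpochhammer c Q k
             * ((1 - 1/(Q*M)) * qpochhammer (1 / M) Q k))
           / (qpochhammer Q Q k * qpochhammer (a*Q/b) Q k * qpochhammer (a*Q/c) Q k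
             * qpochhammer (a * Q * M) Q k) * z ^ k"
        unfolding e4 by simp
      also have "\<dots> = h k * (1 - a * Q^k * Q^k) * (1 - Q^k/(Q*M)) * (1 - a*Q*M*Q^k)"
        unfolding e1 e2 h_def by (simp add: mult_ac)
      finally show ?thesis .
    qed
    \<comment> \<open>Here \<open>K\<close> stands for \<open>Q^k\<close>. Multiplied by
      \<open>h k\<close>, the left side is \<open>G (Suc k) - G k\<close>, and the right side
      combines \<open>T (Suc N) k\<close> and \<open>T N k\<close>.\<close>
    have poly: "z * ((1 - a*K) * (1 - b*K) * (1 - c*K) * (1 - K/(Q*M)))
        - (1 - K) * (1 - a*K/b) * (1 - a*K/c) * (1 - a*Q*M*K)
      = (1 - a*K*K) * ((1 - 1/(Q*M)) * (1 - a*Q*M/b) * (1 - a*Q*M/c) * K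
          - (1 - z) * (1 - K/(Q*M)) * (1 - a*Q*M*K))" for K
      using nz M(1) unfolding z_def by (simp add: divide_simps) algebra
    have G1: "G (Suc k) = h k * (z * ((1 - a*Q^k) * (1 - b*Q^k) * (1 - c*Q^k) * (1 - Q^k/(Q*M))))" for k
    proof -
      define X where "X = (1 - Q*Q^k) * (1 - a*Q/b*Q^k) * (1 - a*Q/c*Q^k) * (1 - a*Q*M*(Q*Q^k))"
      have "X \<noteq> 0" using Qnz[of k] bnz[of k] cnz[of k] anz'[of "Suc k"] by (simp add: X_def)
      moreover have "h (Suc k) = h k * (z * ((1 - a*Q^k) * (1 - b*Q^k) * (1 - c*Q^k) * (1 - Q^k/(Q*M)))) / X"
        unfolding h_def X_def by (simp add: qpochhammer_Suc mult_ac)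
      moreover have "G (Suc k) = h (Suc k) * X"
        unfolding G_def X_def by (simp add: mult.assoc)
      ultimately show ?thesis by simp
    qed
    have "G (Suc k) - G k = (1 - 1/(Q*M)) * ((1 - a*Q*M/b) * (1 - a*Q*M/c) / (1 - a*Q*M) * T (Suc N) k
            - (1 - z) * T N k)" for k
    proof -
      have regroup: "g * (x * (u1 * u2 * u3 * K - v1 * v2 * v3)) = u1 * u2 * u3 * (g * x * K) - v1 * (g * x * v2 * v3)"
        for g x u1 u2 u3 K v1 v2 v3 :: 'a by (simp add: algebra_simps)
      have "G (Suc k) - G k = h k * (z * ((1 - a*Q^k) * (1 - b*Q^k) * (1 - c*Q^k) * (1 - Q^k/(Q*M)))
         - (1 - Q^k) * (1 - a * Q^k/b) * (1 - a*Q^k/c) * (1 - a*Q*M*Q^k))"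
        unfolding G1 by (simp add: G_def right_diff_distrib)
      also have "\<dots> = (1 - 1/(Q*M)) * (1 - a*Q*M/b) * (1 - a*Q*M/c) * (h k * (1 - a * Q^k * Q^k) * Q^k)
           - (1 - z) * (h k * (1 - a * Q^k * Q^k) * (1 - Q^k/(Q*M)) * (1 - a*Q*M*Q^k))"
        unfolding poly by (rule regroup)
      also have "h k * (1 - a * Q^k * Q^k) * Q^k = T (Suc N) k / (1 - a*Q*M)"
        unfolding T1 using M by simp
      finally have G2: "G (Suc k) - G k = (1 - 1/(Q*M)) * (1 - a*Q*M/b) * (1 - a*Q*M/c) * (T (Suc N) k / (1 - a*Q*M))
           - (1 - z) * (h k * (1 - a * Q^k * Q^k) * (1 - Q^k/(Q*M)) * (1 - a*Q*M*Q^k))" .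
      have regroup': "u1 * u2 * u3 * (x / w) - v * (u1 * x') = u1 * (u2 * u3 / w * x - v * x')"
        for u1 u2 u3 w x x' v :: 'a by (simp add: right_diff_distrib mult_ac)
      show ?thesis unfolding G2 T0[symmetric] by (rule regroup')
    qed
    then have "(\<Sum>k<Suc (Suc N). G (Suc k) - G k) = (1 - 1/(Q*M)) * ((1 - a*Q*M/b) * (1 - a*Q*M/c) / (1 - a*Q*M)
          * (\<Sum>k\<le>Suc N. T (Suc N) k) - (1 - z) * (\<Sum>k\<le>Suc N. T N k))"
      by (simp only: lessThan_Suc_atMost sum_subtractf sum_distrib_left[symmetric])
    \<comment> \<open>Both ends of the telescope vanish: \<open>G 0\<close> contains
      \<open>1 - Q^0\<close>, and in \<open>G (Suc (Suc N))\<close> the factor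
      \<open>qpochhammer (1/(Q*M)) Q (Suc (Suc N))\<close> contains
      \<open>1 - Q^(N+1)/Q^(N+1)\<close>.\<close>
    moreover have "(\<Sum>k<Suc (Suc N). G (Suc k) - G k) = 0"
    proof -
      have "qpochhammer (1/(Q*M)) Q (Suc (Suc N)) = 0"
        using nz by (simp add: qpochhammer_Suc M_def)
      then have "G (Suc (Suc N)) = 0" by (simp add: G_def h_def)
      then show ?thesis by (subst sum_lessThan_telescope) (simp add: G_def)
    qed
    moreover have "1 - 1/(Q*M) \<noteq> 0" using M nz by auto
    \<comment> \<open>The telescoped range ends at \<open>Suc N\<close> for both sums; for
      \<open>T N\<close> the last term is zero.\<close>
    moreover have "T N (Suc N) = 0"
      using nz by (simp add: T_def qpochhammer_Suc)
    ultimately have "(1 - a*Q*M/b) * (1 - a*Q*M/c) / (1 - a*Q*M)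
          * (\<Sum>k\<le>Suc N. T (Suc N) k) = (1 - z) * (\<Sum>k\<le>N. T N k)"
      using M nz by simp
    then show ?thesis using M unfolding z_def M_def
      by (simp add: field_simps)
  qed
  have "(\<Sum>k\<le>N. T N k) = ?R N"
  proof (induction N)
    case 0
    show ?case by (simp add: T_def)
  next
    case (Suc N)
    have ne: "qpochhammer (a*Q/b) Q N \<noteq> 0" "qpochhammer (a*Q/c) Q N \<noteq> 0"
      using bnz cnz by (auto intro!: qpochhammer_nonzero)
    define B C where "B = (1 - a*Q/b * Q^N)" and "C = (1 - a*Q/c * Q^N)"
    have BC: "B \<noteq> 0" "C \<noteq> 0" using bnz cnz by (auto simp: B_def C_def)
    have "(\<Sum>k\<le>Suc N. T (Suc N) k) = (1 - a*Q*Q^N) * (1 - a*Q/(b*c) * Q^N) * ?R N / (B * C)"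
    proof -
      have "s = x * y * r / (B * C)" if "B * C * s = x * y * r" for s x y r
        using that BC by (simp add: field_simps)
      from this[OF step[of N, folded B_def C_def]] show ?thesis unfolding Suc .
    qed
    also have "\<dots> = ?R (Suc N)" by (simp add: qpochhammer_Suc B_def C_def mult_ac)
    finally show ?case .
  qed
  then show ?thesis by (simp add: T_def)
qed

text \<open>As \<open>y = a * Q ^ N\<close>, the parameter \<open>a/y\<close> is
  \<open>1 / Q ^ N\<close>. Expanding \<open>(1 - b Q^k)^2\<close> in terms of
  \<open>(1 - a y Q^k) (1 - Q^k/y)\<close> and \<open>Q^k\<close> gives two instances of
  \<open>rogers_6phi5\<close>. The last factor of the result equals
  \<open>a (1 - y)^2/y - 2 b (1 - b)^2\<close>, which exposes its value at
  \<open>y = 1\<close>.\<close>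

lemma deformed_sum_closed_form:
  fixes b Q :: "'a::field"
  defines "a \<equiv> b\<^sup>2"
  assumes nz: "Q \<noteq> 0" "b \<noteq> 0" "a \<noteq> -1"
    and Q: "\<And>j. Q ^ Suc j \<noteq> 1"
    and a: "\<And>j. a * Q ^ j \<noteq> 1"
    and y: "y = a * Q ^ N" "\<And>j. Q ^ j \<noteq> y"
  shows "(\<Sum>k\<le>N. (1 - a * Q ^ (2*k)) * (1 - b * Q^k)\<^sup>2 * (qpochhammer a Q k / qpochhammer Q Q k)\<^sup>2
             * (qpochhammer (a*y) Q k * qpochhammer (a/y) Q k / (qpochhammer (Q*y) Q k * qpochhammer (Q/y) Q k))
             / a ^ (2*k))
       = (1 - y) * qpochhammer (a\<^sup>2) Q N / (a ^ N * qpochhammer Q Q N * (1 + a)) * (a * (1 + y)\<^sup>2 / y - 2 * b * (1 + a))"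
       (is "?S = ?R")
proof -
  have anz: "a \<noteq> 0" and ynz: "y \<noteq> 0" using nz by (auto simp: a_def y)
  have a1: "a \<noteq> 1" using a[of 0] by simp
  have y1: "y \<noteq> 1" using y(2)[of 0] by auto
  have aa: "1 - 1/a\<^sup>2 \<noteq> 0" using a1 nz anz by (auto simp: power2_eq_1_iff)
  have a0: "a * Q ^ Suc j \<noteq> 1" for j using a[of "Suc j"] .
  have aQa: "a * Q ^ Suc j \<noteq> a" for j using Q[of j] anz by simp
  have aQy: "a * Q ^ Suc j \<noteq> a * y" "a * Q ^ Suc j \<noteq> a * y * Q" for j
    using y(2)[of j] y(2)[of "Suc j"] anz nz by auto
  \<comment> \<open>Parameters of \<open>rogers_6phi5\<close> specialized to \<open>b = a\<close>
    and to \<open>c = a y\<close> or \<open>c = a y Q\<close>; the arguments of the two series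
    become \<open>Q/a^2\<close> and \<open>1/a^2\<close>.\<close>
  have s1: "1 / Q ^ N = a / y" "a * Q / a = Q" "a * Q / (a * y) = Q / y" "a * Q ^ Suc N = Q * y"
     "Q * y / (a * (a * y)) = Q / a\<^sup>2" "a * Q / (a * y * Q) = 1 / y" "Q * y / (a * (a * y * Q)) = 1 / a\<^sup>2"
     "a * Q / (a * (a * y)) = Q / (a * y)" "a * Q / (a * (a * y * Q)) = 1 / (a * y)"
    using nz anz ynz by (auto simp: y(1) power2_eq_square divide_simps)
  let ?P = "\<lambda>k. (qpochhammer a Q k * qpochhammer a Q k * qpochhammer (a*y) Q k
             * qpochhammer (a / y) Q k)
           / (qpochhammer Q Q k * qpochhammer Q Q k * qpochhammer (Q/y) Q k
             * qpochhammer (Q * y) Q k)"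
  let ?P2 = "\<lambda>k. (qpochhammer a Q k * qpochhammer a Q k * qpochhammer (a*y*Q) Q k
             * qpochhammer (a / y) Q k)
           / (qpochhammer Q Q k * qpochhammer Q Q k * qpochhammer (1/y) Q k
             * qpochhammer (Q * y) Q k)"
  have R1: "(\<Sum>k\<le>N. (1 - a * Q ^ (2*k)) * ?P k * (Q/a\<^sup>2) ^ k)
       = (1 - a) * qpochhammer (a*Q) Q N * qpochhammer (Q/(a*y)) Q N
           / (qpochhammer Q Q N * qpochhammer (Q/y) Q N)" (is "?S1 = ?R1")
    using rogers_6phi5[where a = a and b = a and c = "a * y" and N = N, OF nz(1) anz anz _ Q a0 aQa aQy(1)] anz ynz
    unfolding s1 by simp
  have R2: "(\<Sum>k\<le>N. (1 - a * Q ^ (2*k)) * ?P2 k * (1/a\<^sup>2) ^ k)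
       = (1 - a) * qpochhammer (a*Q) Q N * qpochhammer (1/(a*y)) Q N
           / (qpochhammer Q Q N * qpochhammer (1/y) Q N)" (is "?S2 = ?R2")
    using rogers_6phi5[where a = a and b = a and c = "a * y * Q" and N = N, OF nz(1) anz anz _ Q a0 aQa aQy(2)] anz ynz nz
    unfolding s1 by simp
  have yj: "1 - 1/y * Q ^ j \<noteq> 0" for j using y(2)[of j] ynz by (auto simp: field_simps)
  have qy: "qpochhammer (1/y) Q k \<noteq> 0" "qpochhammer (Q/y) Q k \<noteq> 0" for k
    using yj yj[of "Suc _"] by (auto intro!: qpochhammer_nonzero)
  have shy: "(1 - 1/y) * qpochhammer (Q/y) Q k = qpochhammer (1/y) Q k * (1 - Q^k/y)" for k
    using qpochhammer_shift[of "1/y" Q k] by (simp add: qpochhammer_Suc)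
  have shay: "(1 - 1/(a*y)) * qpochhammer (Q/(a*y)) Q k = qpochhammer (1/(a*y)) Q k * (1 - Q^k/(a*y))" for k
    using qpochhammer_shift[of "1/(a*y)" Q k] by (simp add: qpochhammer_Suc)
  have shc: "(1 - a*y) * qpochhammer (a*y*Q) Q k = qpochhammer (a*y) Q k * (1 - a*y*Q^k)" for k
    using qpochhammer_shift[of "a*y" Q k] by (simp add: qpochhammer_Suc)
  \<comment> \<open>Contiguity: raising the third parameter from \<open>a y\<close> to
    \<open>a y Q\<close> changes a term only by end factors. The relation stays multiplied out,
    since \<open>a y = 1\<close> is not excluded.\<close>
  have P2: "(1 - a*y) * (1 - 1/y) * ?P2 k = (1 - a*y*Q^k) * (1 - Q^k/y) * ?P k" for k
  proof -
    have "qpochhammer (a*y) Q k * (1 - a*y*Q^k) * (qpochhammer (1/y) Q k * (1 - Q^k/y)) * qpochhammer (1/y) Q k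
      = (1 - a*y) * qpochhammer (a*y*Q) Q k * ((1 - 1/y) * qpochhammer (Q/y) Q k) * qpochhammer (1/y) Q k"
      by (simp only: shc shy)
    then have e: "qpochhammer (a*y) Q k * (1 - a*y*Q^k) * (1 - Q^k/y) / qpochhammer (Q/y) Q k
      = (1 - a*y) * qpochhammer (a*y*Q) Q k * (1 - 1/y) / qpochhammer (1/y) Q k"
      using qy[of k] by (simp add: frac_eq_eq mult_ac)
    have "(1 - a*y) * (1 - 1/y) * ?P2 k = qpochhammer a Q k * qpochhammer a Q k * qpochhammer (a / y) Q k
       / (qpochhammer Q Q k * qpochhammer Q Q k * qpochhammer (Q*y) Q k)
       * ((1 - a*y) * qpochhammer (a*y*Q) Q k * (1 - 1/y) / qpochhammer (1/y) Q k)"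
      by (simp add: mult_ac)
    also have "\<dots> = (1 - a*y*Q^k) * (1 - Q^k/y) * ?P k"
      unfolding e[symmetric] by (simp add: mult_ac)
    finally show ?thesis .
  qed
  have term_eq: "(1 - a * Q ^ (2*k)) * (1 - b * Q^k)\<^sup>2 * (qpochhammer a Q k / qpochhammer Q Q k)\<^sup>2
             * (qpochhammer (a*y) Q k * qpochhammer (a/y) Q k / (qpochhammer (Q*y) Q k * qpochhammer (Q/y) Q k))
             / a ^ (2*k)
     = (1 - a*y) * (1 - 1/y) * ((1 - a * Q ^ (2*k)) * ?P2 k * (1/a\<^sup>2) ^ k)
       + (a*y + 1/y - 2*b) * ((1 - a * Q ^ (2*k)) * ?P k * (Q/a\<^sup>2) ^ k)" for k
  proof -
    \<comment> \<open>The two resulting pieces are \<open>6\<phi>5\<close> summands with third parameter \<open>a y Q\<close> and \<open>a y\<close>.\<close>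
    have sq: "(1 - b * Q^k)\<^sup>2 = (1 - a*y*Q^k) * (1 - Q^k/y) + (a*y + 1/y - 2*b) * Q^k"
      using ynz by (simp add: field_simps power2_eq_square a_def)
    have sq2: "(qpochhammer a Q k / qpochhammer Q Q k)\<^sup>2
        = qpochhammer a Q k * qpochhammer a Q k / (qpochhammer Q Q k * qpochhammer Q Q k)"
      by (simp add: power2_eq_square)
    have "(1 - a*y) * (1 - 1/y) * ((1 - a * Q ^ (2*k)) * ?P2 k * (1/a\<^sup>2) ^ k)
       = ((1 - a*y) * (1 - 1/y) * ?P2 k) * (1 - a * Q ^ (2*k)) / a ^ (2*k)"
      by (simp add: power_divide mult_ac flip: power_mult)
    also have "\<dots> = (1 - a*y*Q^k) * (1 - Q^k/y) * ?P k * (1 - a * Q ^ (2*k)) / a ^ (2*k)"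
      by (simp only: P2)
    finally show ?thesis unfolding sq sq2
      by (simp add: power_divide power_mult[symmetric] distrib_left distrib_right add_divide_distrib mult_ac)
  qed
  have "?S = (1 - a*y) * (1 - 1/y) * ?R2 + (a*y + 1/y - 2*b) * ?R1"
    unfolding term_eq sum.distrib sum_distrib_left[symmetric] R1 R2 ..
  \<comment> \<open>The two closed forms share their products up to a shift by one place. Because
    \<open>Q^N/y = 1/a\<close>, the shift relations at \<open>k = N\<close> end in the factors
    \<open>1 - 1/a\<close> and \<open>1 - 1/a^2\<close>.\<close>
  also have "(1 - a*y) * (1 - 1/y) * ?R2 = ?R1 * ((1 - a*y) * (1 - 1/(a*y)) * a / (1 + a))"
  proof -
    have "1 - Q^N/y = 1 - 1/a" using y(1) nz anz by (simp add: field_simps)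
    then have e1: "qpochhammer (1/y) Q N = (1 - 1/y) * qpochhammer (Q/y) Q N / (1 - 1/a)"
      using shy[of N] a1 by simp
    have "1 - Q^N/(a*y) = 1 - 1/a\<^sup>2" using y(1) nz anz by (simp add: field_simps power2_eq_square)
    then have e2: "qpochhammer (1/(a*y)) Q N = (1 - 1/(a*y)) * qpochhammer (Q/(a*y)) Q N / (1 - 1/a\<^sup>2)"
      using shay[of N] aa by (metis nonzero_eq_divide_eq)
    have "1 - 1/y \<noteq> 0" using y1 by simp
    moreover have "1 - 1/a\<^sup>2 = (1 - 1/a) * ((1 + a) / a)" using anz by (simp add: field_simps power2_eq_square)
    moreover have "1 - 1/a \<noteq> 0" using a1 by simp
    moreover have "A * p * (B * C * (X * D / (r * ((1 + a) / a))) / (E * (p * F / r))) = B * C * D / (E * F) * (A * X * a / (1 + a))"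
      if "p \<noteq> 0" "r \<noteq> 0" for A p B C X D r E F using that by (simp add: mult_ac)
    ultimately show ?thesis unfolding e1 e2 by metis
  qed
  also have "?R1 * ((1 - a*y) * (1 - 1/(a*y)) * a / (1 + a)) + (a*y + 1/y - 2*b) * ?R1
     = ?R1 / (1 + a) * (a * (1 + y)\<^sup>2 / y - 2 * b * (1 + a))"
  proof -
    have "1 + a \<noteq> 0" using nz(3) by (metis add_eq_0_iff)
    then have "(1 - a*y) * (1 - 1/(a*y)) * a / (1 + a) + (a*y + 1/y - 2*b) = (a * (1 + y)\<^sup>2 / y - 2 * b * (1 + a)) / (1 + a)"
      using anz ynz by (simp add: divide_simps) algebra
    then have "?R1 * ((1 - a*y) * (1 - 1/(a*y)) * a / (1 + a) + (a*y + 1/y - 2*b)) = ?R1 * ((a * (1 + y)\<^sup>2 / y - 2 * b * (1 + a)) / (1 + a))"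
      by simp
    then show ?thesis by (simp add: distrib_left mult_ac)
  qed
  also have "?R1 = (1 - y) * qpochhammer (a\<^sup>2) Q N / (a ^ N * qpochhammer Q Q N)"
  proof -
    \<comment> \<open>Reversal of the order of the factors. Used with \<open>x = y\<close> and
      \<open>x = a y\<close>, where \<open>x / Q^N\<close> is \<open>a\<close> and
      \<open>a^2\<close>, it makes \<open>(Q/y;Q)_N\<close> cancel and turns
      \<open>(Q/(a y);Q)_N\<close> into \<open>(a^2;Q)_N\<close>.\<close>
    have rev: "qpochhammer (x / Q ^ N) Q N = (- x) ^ N / Q ^ (\<Sum>j<N. Suc j) * qpochhammer (Q / x) Q N" if "x \<noteq> 0" for x
    proof -
      have "qpochhammer (x / Q ^ N) Q N = (\<Prod>j<N. 1 - x / Q ^ N * Q ^ (N - Suc j))"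
        unfolding qpochhammer_def by (rule prod.nat_diff_reindex[symmetric])
      also have "\<dots> = (\<Prod>j<N. (- x) / Q ^ Suc j * (1 - Q / x * Q ^ j))"
      proof (rule prod.cong[OF refl])
        fix j assume "j \<in> {..<N}"
        then have "N = N - Suc j + Suc j" by simp
        then have "Q ^ N = Q ^ (N - Suc j) * Q ^ Suc j" by (metis power_add)
        then show "1 - x / Q ^ N * Q ^ (N - Suc j) = (- x) / Q ^ Suc j * (1 - Q / x * Q ^ j)"
          using nz that by (simp add: field_simps)
      qed
      also have "\<dots> = (- x) ^ N / Q ^ (\<Sum>j<N. Suc j) * qpochhammer (Q / x) Q N"
        by (simp only: prod.distrib prod_dividef power_sum qpochhammer_def prod_constant card_lessThan)
      finally show ?thesis .
    qed
    have ay: "y / Q ^ N = a" "a * y / Q ^ N = a\<^sup>2" using nz by (simp_all add: y(1) power2_eq_square)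
    have "(1 - a) * qpochhammer (a*Q) Q N = qpochhammer a Q N * (1 - y)"
      using qpochhammer_shift[of a Q N] by (simp add: qpochhammer_Suc y(1))
    moreover have "qpochhammer a Q N = (- y) ^ N / Q ^ (\<Sum>j<N. Suc j) * qpochhammer (Q/y) Q N"
      using rev[of y] ynz ay by simp
    moreover have "qpochhammer (Q/(a*y)) Q N = qpochhammer (a\<^sup>2) Q N / ((- (a*y)) ^ N / Q ^ (\<Sum>j<N. Suc j))"
      using rev[of "a*y"] ynz anz nz ay by simp
    moreover have "(- (a*y)) ^ N = a ^ N * (- y) ^ N" by (simp flip: power_mult_distrib)
    ultimately show ?thesis using qy[of N] nz ynz anz by simp
  qed
  finally show ?thesis by simp
qed

subsection \<open>Antisymmetry of the summand\<close>

text \<open>For \<open>b = q^t\<close> and \<open>Q = q^(2d)\<close> this is the summand of the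
  theorem times \<open>(1 - q^2) (1 - q)^2\<close>. The parameter is \<open>b\<close> and not
  \<open>b^2\<close>, since \<open>b\<close> will be replaced by a nearby element with a prescribed
  square.\<close>

definition wp_term :: "'a::field \<Rightarrow> 'a \<Rightarrow> nat \<Rightarrow> 'a" where
  "wp_term b Q k = (1 - b\<^sup>2 * (Q^k)\<^sup>2) * (1 - b * Q^k)\<^sup>2
     * (qpochhammer (b\<^sup>2) Q k / qpochhammer Q Q k) ^ 4 / b ^ (4*k)"

text \<open>The classical evaluation of \<open>(Q^(-s);Q)_r\<close> as
  \<open>(Q;Q)_s / (Q;Q)_(s-r)\<close> up to sign and a power of \<open>Q\<close>: each new factor
  satisfies \<open>1 - Q^r/Q^s = - Q^r/Q^s (1 - Q^(s-r))\<close>.\<close>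

lemma qpochhammer_quotient_reverse:
  fixes Q :: "'a::field"
  assumes "Q \<noteq> 0" "r \<le> s"
  shows "qpochhammer (1 / Q^s) Q r * qpochhammer Q Q (s - r)
       = (-1)^r * Q ^ (\<Sum>j<r. j) / Q ^ (s*r) * qpochhammer Q Q s"
  using assms(2)
proof (induction r)
  case (Suc r)
  have "s - r = Suc (s - Suc r)" using Suc by simp
  then have e: "qpochhammer Q Q (s - r) = qpochhammer Q Q (s - Suc r) * (1 - Q ^ (s - r))"
    by (metis qpochhammer_Suc power_Suc)
  have "s = r + (s - r)" using Suc by simp
  then have "Q ^ s = Q ^ r * Q ^ (s - r)" by (metis power_add)
  then have f: "1 - 1 / Q^s * Q^r = - (Q^r) / Q^s * (1 - Q ^ (s - r))"
    using assms(1) by (simp add: field_simps)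
  have "qpochhammer (1 / Q^s) Q (Suc r) * qpochhammer Q Q (s - Suc r)
     = (- (Q^r) / Q^s) * (qpochhammer (1 / Q^s) Q r * qpochhammer Q Q (s - r))"
    unfolding e qpochhammer_Suc f by (simp add: mult_ac)
  also have "\<dots> = (- (Q^r) / Q^s) * ((-1)^r * Q ^ (\<Sum>j<r. j) / Q ^ (s*r) * qpochhammer Q Q s)"
    using Suc by simp
  also have "\<dots> = (-1)^Suc r * Q ^ (\<Sum>j<Suc r. j) / Q ^ (s * Suc r) * qpochhammer Q Q s"
    by (simp add: power_add)
  finally show ?case .
qed simp

lemma power_triangular: "(Q::'a::comm_monoid_mult) ^ (\<Sum>j<r. j) * Q ^ (\<Sum>j<r. j) * Q ^ r = Q ^ (r * r)"
proof -
  have "(\<Sum>j<r. j) + (\<Sum>j<r. j) + r = r * r" by (induction r) auto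
  then show ?thesis by (metis power_add)
qed

text \<open>For \<open>b^2 = Q^(-s)\<close> the Pochhammer quotient is, up to sign and a power of
  \<open>Q\<close>, the Gaussian binomial coefficient of \<open>s\<close> over \<open>r\<close>,
  which is symmetric under \<open>r |-> s - r\<close>. What remains,
  \<open>(1 - b^2 U^2) (1 - b U)^2 / U^2\<close> with \<open>U = Q^r\<close>, changes sign under
  \<open>U |-> 1/(b^2 U)\<close>.\<close>

lemma wp_term_reflect:
  fixes b Q :: "'a::field"
  assumes Q: "Q \<noteq> 0" "\<And>j. Suc j \<le> s \<Longrightarrow> Q ^ Suc j \<noteq> 1" and b: "b\<^sup>2 * Q^s = 1" and r: "r \<le> s"
  shows "wp_term b Q (s - r) = - wp_term b Q r"
proof -
  have bnz: "b \<noteq> 0" using b by auto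
  have b2: "b\<^sup>2 = 1 / Q^s" using b Q by (simp add: field_simps)
  have nz: "qpochhammer Q Q k \<noteq> 0" if "k \<le> s" for k
    using Q that by (auto intro!: qpochhammer_nonzero)
  have main: "wp_term b Q r = (1 - b\<^sup>2 * (Q^r)\<^sup>2) * (1 - b * Q^r)\<^sup>2 / (Q^r)\<^sup>2
      * ((qpochhammer Q Q s / (qpochhammer Q Q r * qpochhammer Q Q (s - r))) ^ 4 / Q ^ (2 * (r * (s - r))))"
    if r: "r \<le> s" for r
  proof -
    have "qpochhammer (b\<^sup>2) Q r / qpochhammer Q Q r
        = (-1)^r * (Q ^ (\<Sum>j<r. j) / Q ^ (s*r)) * (qpochhammer Q Q s / (qpochhammer Q Q r * qpochhammer Q Q (s - r)))"
    proof -
      have "qpochhammer (b\<^sup>2) Q r = (-1)^r * Q ^ (\<Sum>j<r. j) / Q ^ (s*r) * qpochhammer Q Q s / qpochhammer Q Q (s - r)"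
        using qpochhammer_quotient_reverse[OF Q(1) r] nz[of "s-r"] r unfolding b2
        by (simp only: nonzero_eq_divide_eq diff_le_self simp_thms)
      then show ?thesis by (simp add: mult_ac)
    qed
    moreover have "((-1::'a) ^ r) ^ 4 = 1" by (simp flip: power_mult)
    ultimately have "(qpochhammer (b\<^sup>2) Q r / qpochhammer Q Q r) ^ 4
        = (Q ^ (\<Sum>j<r. j) / Q ^ (s*r)) ^ 4 * (qpochhammer Q Q s / (qpochhammer Q Q r * qpochhammer Q Q (s - r))) ^ 4"
      by (simp only: power_mult_distrib mult_1)
    \<comment> \<open>Since \<open>b^(4r) = Q^(-2sr)\<close>, the exponents of \<open>Q\<close> add
      up to \<open>-2r - 2r(s-r)\<close>; only the part \<open>-2r\<close> is not symmetric under
      \<open>r |-> s - r\<close>.\<close>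
    moreover have "(Q ^ (\<Sum>j<r. j) / Q ^ (s*r)) ^ 4 / b ^ (4*r) = 1 / (Q^r)\<^sup>2 / Q ^ (2 * (r * (s - r)))"
    proof -
      have "(Q ^ (\<Sum>j<r. j)) ^ 4 * (Q^r)\<^sup>2 = (Q ^ (\<Sum>j<r. j) * Q ^ (\<Sum>j<r. j) * Q^r)\<^sup>2"
        by (simp add: power_mult_distrib power4_eq_xxxx power2_eq_square mult_ac)
      also have "\<dots> = Q ^ (2 * (r*r))" unfolding power_triangular by (simp add: mult.commute flip: power_mult)
      finally have 1: "(Q ^ (\<Sum>j<r. j)) ^ 4 = Q ^ (2 * (r*r)) / (Q^r)\<^sup>2" using Q by (simp add: field_simps)
      have "b ^ (4*r) = (b\<^sup>2) ^ (2*r)" by (simp flip: power_mult)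
      then have 2: "b ^ (4*r) = 1 / Q ^ (2*(s*r))" by (simp add: b2 power_divide mult_ac flip: power_mult)
      have "s * r = r * r + r * (s - r)" using r by (simp add: algebra_simps diff_mult_distrib2)
      then have 3: "Q ^ (2*(s*r)) = Q ^ (2*(r*r)) * Q ^ (2 * (r * (s-r)))"
        by (metis distrib_left power_add)
      have 4: "(Q ^ (s*r)) ^ 4 = Q ^ (2*(s*r)) * Q ^ (2*(s*r))"
        by (simp add: mult.commute flip: power_mult power_add)
      show ?thesis unfolding power_divide 1 2 4 using Q by (simp add: 3)
    qed
    moreover have "x * (e * g) / B = x / U * (g / W)" if "e / B = 1 / U / W" for x e g B U W :: 'a
    proof -
      have "x * (e * g) / B = x * g * (e / B)" by simp
      then show ?thesis unfolding that by simp
    qed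
    ultimately show ?thesis unfolding wp_term_def by (simp only: power_divide)
  qed
  define U V where "U = Q^r" and "V = Q^(s-r)"
  have "U * V = Q^s" using r by (simp add: U_def V_def flip: power_add)
  then have UV: "b\<^sup>2 * (U * V) = 1" using b by simp
  have nzUV: "U \<noteq> 0" "V \<noteq> 0" using Q by (auto simp: U_def V_def)
  have V: "V = 1 / (b\<^sup>2 * U)" using UV nzUV bnz by (simp add: field_simps)
  have e: "(1 - b\<^sup>2 * V\<^sup>2) * (1 - b * V)\<^sup>2 / V\<^sup>2 = - ((1 - b\<^sup>2 * U\<^sup>2) * (1 - b * U)\<^sup>2 / U\<^sup>2)"
    unfolding V using nzUV bnz by (simp add: divide_simps) (simp add: algebra_simps power2_eq_square power4_eq_xxxx)
  have "wp_term b Q (s - r) = (1 - b\<^sup>2 * V\<^sup>2) * (1 - b * V)\<^sup>2 / V\<^sup>2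
      * ((qpochhammer Q Q s / (qpochhammer Q Q r * qpochhammer Q Q (s - r))) ^ 4 / Q ^ (2 * (r * (s - r))))"
    using main[of "s - r"] r by (simp add: V_def mult.commute)
  then show ?thesis unfolding e main[OF r] U_def by simp
qed

text \<open>Reversing the order of summation negates the sum. The weight \<open>g\<close> is
  constant for the plain sums and a first-order coefficient for the cubic congruence.\<close>

lemma wp_term_symmetric_sum:
  fixes b Q :: "'a::field"
  assumes Q: "Q \<noteq> 0" "\<And>j. Suc j \<le> s \<Longrightarrow> Q ^ Suc j \<noteq> 1" and b: "b\<^sup>2 * Q^s = 1" and two: "(2::'a) \<noteq> 0"
    and g: "\<And>r. r \<le> s \<Longrightarrow> g (s - r) = g r"
  shows "(\<Sum>r\<le>s. wp_term b Q r * g r) = 0"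
proof -
  have "(\<Sum>r\<le>s. wp_term b Q r * g r) = (\<Sum>r\<le>s. wp_term b Q (s - r) * g (s - r))"
    by (rule sum.reindex_bij_witness[of _ "\<lambda>r. s - r" "\<lambda>r. s - r"]) auto
  also have "\<dots> = - (\<Sum>r\<le>s. wp_term b Q r * g r)"
    using wp_term_reflect[OF Q b] g by (simp add: sum_negf)
  finally have "2 * (\<Sum>r\<le>s. wp_term b Q r * g r) = 0" by (metis add_eq_0_iff mult_2)
  then show ?thesis using two by simp
qed

subsection \<open>Congruences in a discrete valuation ring\<close>

text \<open>\<open>R\<close> plays the part of the localization at a prime and \<open>p\<close> that
  of a uniformizer: by \<open>local\<close>, every nonunit is a multiple of \<open>p\<close>. Taking
  a subset of a field keeps all quotients in one type.\<close>

locale valuation_subring =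
  fixes R :: "'a::field set" and p :: 'a
  assumes one_R: "1 \<in> R"
    and add_R: "x \<in> R \<Longrightarrow> y \<in> R \<Longrightarrow> x + y \<in> R"
    and minus_R: "x \<in> R \<Longrightarrow> - x \<in> R"
    and mult_R: "x \<in> R \<Longrightarrow> y \<in> R \<Longrightarrow> x * y \<in> R"
    and p_R: "p \<in> R" and p_nz: "p \<noteq> 0" and p_nonunit: "inverse p \<notin> R"
    and local: "x \<in> R \<Longrightarrow> inverse x \<notin> R \<Longrightarrow> x / p \<in> R"
begin

definition I :: "nat \<Rightarrow> 'a set" where "I e = {x. x / p ^ e \<in> R}"

definition unit :: "'a \<Rightarrow> bool" where "unit x \<longleftrightarrow> x \<noteq> 0 \<and> x \<in> R \<and> inverse x \<in> R"

definition cg :: "'a \<Rightarrow> 'a \<Rightarrow> bool" (infix "\<approx>" 50) where "x \<approx> y \<longleftrightarrow> x - y \<in> I 1"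

lemma zero_R: "0 \<in> R" using add_R[OF one_R minus_R[OF one_R]] by simp

lemma diff_R: "x \<in> R \<Longrightarrow> y \<in> R \<Longrightarrow> x - y \<in> R"
  using add_R[OF _ minus_R] by fastforce

lemma power_R: "x \<in> R \<Longrightarrow> x ^ k \<in> R"
  by (induction k) (auto intro: one_R mult_R)

lemma sum_R: "(\<And>k. k \<in> A \<Longrightarrow> f k \<in> R) \<Longrightarrow> sum f A \<in> R"
  by (induction A rule: infinite_finite_induct) (auto intro: zero_R add_R)

lemma prod_R: "(\<And>k. k \<in> A \<Longrightarrow> f k \<in> R) \<Longrightarrow> prod f A \<in> R"
  by (induction A rule: infinite_finite_induct) (auto intro: one_R mult_R)

lemma of_nat_R: "of_nat k \<in> R"
  by (induction k) (auto intro: zero_R one_R add_R)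

lemma numeral_R: "numeral k \<in> R"
  using of_nat_R[of "numeral k"] by simp

lemma unit_R: "unit x \<Longrightarrow> x \<in> R" by (simp add: unit_def)

lemma unit_nz: "unit x \<Longrightarrow> x \<noteq> 0" by (simp add: unit_def)

lemma divide_R: "x \<in> R \<Longrightarrow> unit y \<Longrightarrow> x / y \<in> R"
  by (simp add: unit_def divide_inverse mult_R)

lemmas R_intros = zero_R one_R add_R minus_R diff_R mult_R power_R numeral_R divide_R

lemma unit_one: "unit 1" by (simp add: unit_def one_R)

lemma unit_mult: "unit x \<Longrightarrow> unit y \<Longrightarrow> unit (x * y)"
  by (simp add: unit_def mult_R)

lemma unit_inverse: "unit x \<Longrightarrow> unit (inverse x)"
  by (simp add: unit_def)

lemma unit_minus: "unit x \<Longrightarrow> unit (- x)"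
  by (simp add: unit_def minus_R)

lemma unit_power: "unit x \<Longrightarrow> unit (x ^ k)"
  by (induction k) (auto intro: unit_one unit_mult)

lemma unit_powi: "unit x \<Longrightarrow> unit (x powi k)"
  by (cases k rule: int_cases2) (auto simp: power_int_minus intro: unit_power unit_inverse)

lemma I_0: "I 0 = R" by (simp add: I_def)

lemma I_zero: "0 \<in> I e" by (simp add: I_def zero_R)

lemma I_add: "x \<in> I e \<Longrightarrow> y \<in> I e \<Longrightarrow> x + y \<in> I e"
  by (simp add: I_def add_divide_distrib add_R)

lemma I_minus: "x \<in> I e \<Longrightarrow> - x \<in> I e"
  using minus_R[of "x / p^e"] by (simp add: I_def)

lemma I_diff: "x \<in> I e \<Longrightarrow> y \<in> I e \<Longrightarrow> x - y \<in> I e"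
  by (simp add: I_def diff_divide_distrib diff_R)

lemma I_sum: "(\<And>k. k \<in> A \<Longrightarrow> f k \<in> I e) \<Longrightarrow> sum f A \<in> I e"
  by (induction A rule: infinite_finite_induct) (auto intro: I_zero I_add)

lemma I_mult: "x \<in> I e \<Longrightarrow> y \<in> I f \<Longrightarrow> x * y \<in> I (e + f)"
  using mult_R[of "x / p^e" "y / p^f"] by (simp add: I_def power_add)

lemma I_multR: "x \<in> I e \<Longrightarrow> y \<in> R \<Longrightarrow> x * y \<in> I e" "y \<in> R \<Longrightarrow> x \<in> I e \<Longrightarrow> y * x \<in> I e"
  using I_mult[of x e y 0] by (simp_all add: I_0 mult.commute)

lemma I_divide: "x \<in> I e \<Longrightarrow> unit y \<Longrightarrow> x / y \<in> I e"
  by (simp add: divide_inverse I_multR unit_def)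

lemma I_mono: "e \<le> f \<Longrightarrow> x \<in> I f \<Longrightarrow> x \<in> I e"
proof -
  assume *: "e \<le> f" "x \<in> I f"
  then obtain k where "f = e + k" using le_Suc_ex by blast
  then show ?thesis using * p_nz mult_R[OF _ power_R[OF p_R, of k], of "x / p ^ f"]
    by (simp add: I_def power_add)
qed

lemma I_power: "x \<in> I e \<Longrightarrow> x ^ k \<in> I (k * e)"
  by (induction k) (auto simp: I_0 one_R intro: I_mult)

lemma I_R: "x \<in> I e \<Longrightarrow> x \<in> R"
  using I_mono[of 0 e x] by (simp add: I_0)

lemma unit_iff: "unit x \<longleftrightarrow> x \<in> R \<and> x \<notin> I 1"
proof
  assume x: "unit x"
  have False if "x \<in> I 1"
  proof -
    have "x / p * inverse x \<in> R" using that x by (intro mult_R) (auto simp: I_def unit_def)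
    then show False using p_nonunit unit_nz[OF x] by (simp add: field_simps)
  qed
  then show "x \<in> R \<and> x \<notin> I 1" using x by (auto simp: unit_def)
next
  assume "x \<in> R \<and> x \<notin> I 1"
  then show "unit x" using local[of x] I_zero[of 1] by (auto simp: unit_def I_def)
qed

lemma I_prime: "x \<in> R \<Longrightarrow> y \<in> R \<Longrightarrow> x * y \<in> I 1 \<Longrightarrow> x \<in> I 1 \<or> y \<in> I 1"
  using unit_mult[of x y] by (auto simp: unit_iff)

lemma cg_refl: "x \<approx> x" by (simp add: cg_def I_zero)

lemma cg_sym: "x \<approx> y \<Longrightarrow> y \<approx> x"
  using I_minus[of "x - y" 1] by (simp add: cg_def)

lemma cg_trans [trans]: "x \<approx> y \<Longrightarrow> y \<approx> z \<Longrightarrow> x \<approx> z"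
  using I_add[of "x - y" 1 "y - z"] by (simp add: cg_def)

lemma cg_add: "x \<approx> x' \<Longrightarrow> y \<approx> y' \<Longrightarrow> x + y \<approx> x' + y'"
  using I_add[of "x - x'" 1 "y - y'"] by (simp add: cg_def algebra_simps)

lemma cg_diff: "x \<approx> x' \<Longrightarrow> y \<approx> y' \<Longrightarrow> x - y \<approx> x' - y'"
  using I_diff[of "x - x'" 1 "y - y'"] by (simp add: cg_def algebra_simps)

lemma cg_mult: "x \<approx> x' \<Longrightarrow> y \<approx> y' \<Longrightarrow> x \<in> R \<Longrightarrow> y' \<in> R \<Longrightarrow> x * y \<approx> x' * y'"
  using I_add[OF I_multR(2)[of x "y - y'" 1] I_multR(1)[of "x - x'" 1 y']]
  by (simp add: cg_def algebra_simps)

lemma cg_R: "x \<approx> y \<Longrightarrow> x \<in> R \<Longrightarrow> y \<in> R"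
  using diff_R[of x "x - y"] I_R[of "x - y" 1] by (simp add: cg_def)

lemma cg_unit: "x \<approx> y \<Longrightarrow> unit x \<Longrightarrow> unit y"
  using I_add[of "x - y" 1 y] by (auto simp: unit_iff cg_R) (simp add: cg_def)

lemma cg_divide:
  assumes "x \<approx> x'" "y \<approx> y'" "x \<in> R" "unit y"
  shows "x / y \<approx> x' / y'"
proof -
  have y': "unit y'" using assms cg_unit by blast
  have "x * y' \<approx> x' * y"
    using cg_mult[OF assms(1) cg_sym[OF assms(2)]] assms by (auto simp: unit_def)
  then have "(x * y' - x' * y) / (y * y') \<in> I 1"
    using unit_mult[OF assms(4) y'] by (simp add: cg_def I_divide)
  then show ?thesis using unit_nz[OF y'] unit_nz[OF assms(4)] by (simp add: cg_def diff_frac_eq)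
qed

lemma cg_power: "x \<approx> x' \<Longrightarrow> x \<in> R \<Longrightarrow> x ^ k \<approx> x' ^ k"
  by (induction k) (auto intro!: cg_refl cg_mult power_R intro: cg_R)

lemma cg_sum: "(\<And>k. k \<in> A \<Longrightarrow> f k \<approx> g k) \<Longrightarrow> sum f A \<approx> sum g A"
  by (induction A rule: infinite_finite_induct) (auto intro: cg_refl cg_add)

lemma cg_I: "x \<approx> y \<Longrightarrow> y \<in> I 1 \<Longrightarrow> x \<in> I 1"
  using I_add[of "x - y" 1 y] by (simp add: cg_def)

text \<open>First-order expansion in \<open>w\<close>: a single factor is
  \<open>A/C (1 - w (B/A - D/C))\<close> up to a multiple of \<open>w^2\<close>, and first-order
  coefficients add up in a product.\<close>

lemma perturbed_quotient_prod:
  fixes k :: nat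
  assumes w: "w \<in> I e" "e > 0"
    and AC: "\<And>j. j < k \<Longrightarrow> unit (A j) \<and> unit (C j)"
    and BD: "\<And>j. j < k \<Longrightarrow> B j \<in> R \<and> D j \<in> R"
  shows "(\<Prod>j<k. (A j - w * B j) / (C j - w * D j))
       - (\<Prod>j<k. A j / C j) * (1 - w * (\<Sum>j<k. B j / A j - D j / C j)) \<in> I (2 * e)"
  using AC BD
proof (induction k)
  case 0
  show ?case by (simp add: I_zero)
next
  case (Suc k)
  let ?P = "\<Prod>j<k. (A j - w * B j) / (C j - w * D j)"
  let ?Q = "\<Prod>j<k. A j / C j"
  let ?S = "\<Sum>j<k. B j / A j - D j / C j"
  define s where "s = B k / A k - D k / C k"
  define f where "f = (A k - w * B k) / (C k - w * D k)"
  have uk: "unit (A k)" "unit (C k)" "B k \<in> R" "D k \<in> R" using Suc.prems by auto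
  have w1: "w \<in> I 1" using w I_mono[of 1 e] by auto
  have den: "unit (C k - w * D k)"
    using cg_unit[OF _ uk(2), of "C k - w * D k"] I_multR(1)[OF w1 uk(4)] by (simp add: cg_def)
  have fR: "f \<in> R" unfolding f_def using uk den I_R[OF w(1)] by (intro R_intros) (auto simp: unit_def)
  have sR: "s \<in> R" unfolding s_def using uk by (intro R_intros) auto
  have QR: "?Q \<in> R" using Suc.prems by (auto intro!: prod_R divide_R simp: unit_def)
  have SR: "?S \<in> R" using Suc.prems by (intro sum_R diff_R divide_R) auto
  have ww: "w * w \<in> I (2 * e)" using I_mult[OF w(1) w(1)] by (simp add: mult_2)
  \<comment> \<open>The exact second-order remainder of one factor, with \<open>w * w\<close> split
    off.\<close>
  have "f - A k / C k * (1 - w * s) = w * w * (D k * (A k * D k - B k * C k) / (C k * C k * (C k - w * D k)))"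
    (is "_ = _ * ?X")
    unfolding f_def s_def using unit_nz[OF uk(1)] unit_nz[OF uk(2)] unit_nz[OF den]
    by (simp add: divide_simps) algebra
  moreover have "?X \<in> R" using uk den unit_mult by (intro R_intros) (auto simp: unit_R)
  ultimately have fs: "f - A k / C k * (1 - w * s) \<in> I (2*e)" using I_multR(1)[OF ww, of ?X] by (simp only:)
  \<comment> \<open>The error of the longer product consists of the inherited error, the error of
    the new factor, and the product of the two first-order terms.\<close>
  have "f * P - Q * g * (1 - w * (S + s)) = f * (P - Q * (1 - w * S)) + Q * (1 - w * S) * (f - g * (1 - w * s))
       + w * w * (Q * g * S * s)" for P Q g S
    by (simp add: algebra_simps)
  then have "f * ?P - ?Q * (A k / C k) * (1 - w * (?S + s))
     = f * (?P - ?Q * (1 - w * ?S)) + ?Q * (1 - w * ?S) * (f - A k / C k * (1 - w * s))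
       + w * w * (?Q * (A k / C k) * ?S * s)" .
  moreover have "f * (?P - ?Q * (1 - w * ?S)) \<in> I (2*e)"
    using Suc fR by (intro I_multR(2)) auto
  moreover have "?Q * (1 - w * ?S) * (f - A k / C k * (1 - w * s)) \<in> I (2*e)"
    using QR SR I_R[OF w(1)] by (intro I_multR(2) fs R_intros) auto
  moreover have "w * w * (?Q * (A k / C k) * ?S * s) \<in> I (2*e)"
    using QR SR sR uk by (intro I_multR(1)[OF ww] R_intros) (auto simp: unit_def)
  ultimately show ?case by (simp add: f_def[symmetric] s_def[symmetric] mult_ac I_add)
qed

end

subsection \<open>A root of unity modulo a prime\<close>

text \<open>\<open>m\<close> is the order of \<open>q^2\<close> in the residue field. Together,
  \<open>ord\<close> and \<open>exact\<close> say that \<open>1 - q^(2j)\<close> is \<open>p\<close>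
  times a unit whenever \<open>m\<close> divides \<open>j \<noteq> 0\<close>; by
  \<open>nonroot\<close> it vanishes only at \<open>j = 0\<close>.\<close>

locale cyclotomic_subring = valuation_subring R p for R :: "'a::field set" and p +
  fixes q :: 'a and d :: int and m :: nat
  assumes q_unit: "unit q" and two_unit: "unit 2" and m_pos: "m > 0" and d_ge: "d \<ge> 2"
    and dm: "coprime d (int m)"
    and ord: "1 - q powi (2*j) \<in> I 1 \<longleftrightarrow> int m dvd j"
    and exact: "int m dvd j \<Longrightarrow> j \<noteq> 0 \<Longrightarrow> p / (1 - q powi (2*j)) \<in> R"
    and nonroot: "q powi j = 1 \<Longrightarrow> j = 0"
begin

declare One_nat_def [simp del]

definition Q where "Q = q powi (2*d)"

definition E where "E j = 1 - q powi (2*j)"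

text \<open>Indexed by the exponent \<open>i\<close> instead of by \<open>q^(2i)\<close>, so that
  divisibility by \<open>p\<close> can be read off from residues modulo \<open>m\<close>.\<close>

definition beta where "beta i k = qpochhammer (q powi (2*i)) Q k / qpochhammer Q Q k"

lemma d_pos: "d > 0" using d_ge by simp

lemma q_nz [simp]: "q \<noteq> 0" using q_unit unit_nz by blast

lemma powi_unit: "unit (q powi j)" by (intro unit_powi q_unit)

lemma powi_R: "q powi j \<in> R" using powi_unit unit_R by blast

lemma Q_unit: "unit Q" by (simp add: Q_def powi_unit)

lemma Q_nz [simp]: "Q \<noteq> 0" using Q_unit unit_nz by blast

lemma Q_power: "Q ^ k = q powi (2 * (d * int k))"
  by (simp add: Q_def power_int_power' mult.assoc)

lemma E_shift: "1 - q powi (2*i) * Q ^ k = E (i + d * int k)"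
  by (simp add: E_def Q_power distrib_left flip: power_int_add)

lemma E_Q: "1 - Q * Q ^ k = E (d * int (Suc k))"
  using E_shift[of d k] by (simp add: Q_def distrib_left)

lemma E_R: "E j \<in> R" by (simp add: E_def one_R powi_R diff_R)

lemma E_I: "E j \<in> I 1 \<longleftrightarrow> int m dvd j" by (simp add: E_def ord)

lemma E_unit: "\<not> int m dvd j \<Longrightarrow> unit (E j)" by (simp add: unit_iff E_R E_I)

lemma E_nz: "j \<noteq> 0 \<Longrightarrow> E j \<noteq> 0" using nonroot[of "2*j"] by (auto simp: E_def)

text \<open>\<open>E j\<close> contains at most one factor \<open>p\<close>, and the factor
  \<open>p\<close> in \<open>x\<close> pays for it.\<close>

lemma divide_E_R: "x \<in> I 1 \<Longrightarrow> j \<noteq> 0 \<Longrightarrow> x / E j \<in> R"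
proof (cases "int m dvd j")
  case True
  assume "x \<in> I 1" "j \<noteq> 0"
  then have "x / p * (p / E j) \<in> R" using exact[OF True] by (intro mult_R) (auto simp: I_def E_def)
  then show ?thesis using p_nz by simp
qed (auto intro: divide_R I_R E_unit)

lemma powi_cg: "int m dvd i - j \<Longrightarrow> q powi (2*i) \<approx> q powi (2*j)"
proof -
  assume "int m dvd i - j"
  then have "q powi (2*j) * - E (i - j) \<in> I 1" by (intro I_multR(2) powi_R I_minus) (simp add: E_I)
  then show ?thesis unfolding cg_def E_def
    by (simp add: right_diff_distrib flip: power_int_add)
qed

lemma E_cg: "int m dvd i - j \<Longrightarrow> E i \<approx> E j"
  unfolding E_def by (intro cg_diff cg_refl powi_cg)

text \<open>\<open>d\<close> is invertible modulo \<open>m\<close>; with \<open>x\<close> its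
  inverse, \<open>s\<close> is the residue of \<open>- i x\<close>. At this position of a block the
  numerator of \<open>beta i\<close> becomes divisible by \<open>p\<close>.\<close>

lemma ex_zero: "\<exists>s<m. int m dvd i + d * int s"
proof -
  obtain x where "[d * x = 1] (mod int m)" using cong_solve_coprime_int[OF dm] by blast
  then have x: "int m dvd d * x - 1" by (simp add: cong_iff_dvd_diff)
  define s where "s = nat ((- i * x) mod int m)"
  have s: "int s = (- i * x) mod int m" using m_pos by (simp add: s_def)
  have "int m dvd - i * x - int s" unfolding s by (simp add: mod_eq_dvd_iff[symmetric])
  then have "int m dvd d * (- i * x - int s)" by simp
  moreover have "int m dvd i * (d * x - 1)" using x by simp
  ultimately have "int m dvd - (d * (- i * x - int s) + i * (d * x - 1))" by (simp only: dvd_add dvd_minus_iff)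
  also have "- (d * (- i * x - int s) + i * (d * x - 1)) = i + d * int s" by (simp add: algebra_simps)
  finally have "int m dvd i + d * int s" .
  moreover have "s < m" using s m_pos by (metis of_nat_less_iff pos_mod_bound of_nat_0_less_iff)
  ultimately show ?thesis by blast
qed

lemma dvd_shift_iff: "int m dvd i + d * int s \<Longrightarrow> int m dvd i + d * int k \<longleftrightarrow> k mod m = s mod m"
proof -
  assume *: "int m dvd i + d * int s"
  have "i + d * int k = (i + d * int s) + d * (int k - int s)" by (simp add: algebra_simps)
  then have "int m dvd i + d * int k \<longleftrightarrow> int m dvd d * (int k - int s)"
    using * by (metis dvd_add_right_iff)
  also have "\<dots> \<longleftrightarrow> int m dvd int k - int s"
    using dm by (simp add: coprime_commute coprime_dvd_mult_right_iff)
  also have "\<dots> \<longleftrightarrow> k mod m = s mod m"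
    by (metis mod_eq_dvd_iff of_nat_eq_iff of_nat_mod)
  finally show ?thesis .
qed

lemma dvd_d_iff: "int m dvd d * int k \<longleftrightarrow> m dvd k"
  using dm by (simp add: coprime_commute coprime_dvd_mult_right_iff)

section \<open>Integrality and block structure of the Pochhammer quotients\<close>

lemma beta_0 [simp]: "beta i 0 = 1" by (simp add: beta_def)

lemma beta_Suc: "beta i (Suc k) = beta i k * (E (i + d * int k) / E (d * int (Suc k)))"
  by (simp add: beta_def qpochhammer_Suc E_shift E_Q)

text \<open>In the step from \<open>k\<close> to \<open>Suc k\<close> the numerator gains a factor
  \<open>p\<close> if \<open>k\<close> is \<open>s\<close> modulo \<open>m\<close>, the denominator
  if \<open>m\<close> divides \<open>Suc k\<close>. As \<open>s < m\<close>, the gain never comes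
  after the loss within a block, and between the two \<open>beta i k\<close> lies in
  \<open>I 1\<close>.\<close>

lemma beta_integral_aux:
  assumes s: "s < m" "int m dvd i + d * int s"
  shows "beta i k \<in> R \<and> (s < k mod m \<longrightarrow> beta i k \<in> I 1)"
proof (induction k)
  case (Suc k)
  let ?x = "beta i k * E (i + d * int k)"
  have xR: "?x \<in> R" using Suc E_R mult_R by blast
  have zero: "?x \<in> I 1" if "s \<le> k mod m"
  proof (cases "k mod m = s")
    case True
    then have "E (i + d * int k) \<in> I 1" using dvd_shift_iff[OF s(2)] s(1) by (simp add: E_I)
    then show ?thesis using Suc I_multR by blast
  next
    case False
    then show ?thesis using that Suc E_R by (intro I_multR(1)) auto
  qed
  have nz: "d * int (Suc k) \<noteq> 0" using d_pos by simp
  have eq: "beta i (Suc k) = ?x / E (d * int (Suc k))" by (simp add: beta_Suc)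
  show ?case
  proof (cases "m dvd Suc k")
    case True
    then have km: "Suc (k mod m) = m" using m_pos by (metis dvd_imp_mod_0 mod_Suc nat.distinct(1))
    then have "?x \<in> I 1" using s(1) by (intro zero) simp
    then show ?thesis unfolding eq using divide_E_R[OF _ nz] True by simp
  next
    case False
    then have u: "unit (E (d * int (Suc k)))" using dvd_d_iff by (intro E_unit) blast
    have "Suc k mod m = Suc (k mod m)" using False by (metis mod_Suc mod_greater_zero_iff_not_dvd less_numeral_extra(3))
    then show ?thesis unfolding eq using divide_R[OF xR u] I_divide[OF zero u] by auto
  qed
qed (use s in \<open>auto intro: one_R\<close>)

lemma beta_R: "beta i k \<in> R" using beta_integral_aux ex_zero by blast

lemma beta_I: "s < k mod m \<Longrightarrow> s < m \<Longrightarrow> int m dvd i + d * int s \<Longrightarrow> beta i k \<in> I 1"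
  using beta_integral_aux by blast

text \<open>A property of \<open>q\<close>-Lucas type: modulo \<open>p\<close> the factors added
  after a block boundary depend on their position only modulo \<open>m\<close>, and for
  \<open>r < m\<close> none of the new denominators is divisible by \<open>p\<close>.\<close>

lemma beta_shift:
  assumes "int m dvd i - i'" "r < m"
  shows "beta i (l * m + r) \<approx> beta i (l * m) * beta i' r"
  using assms(2)
proof (induction r)
  case 0
  show ?case by (simp add: cg_refl)
next
  case (Suc r)
  have "E (i + d * int (l*m+r)) \<approx> E (i' + d * int r)"
    proof (rule E_cg)
    have "int m dvd (i - i') + int m * (d * int l)" using assms(1) by (intro dvd_add) auto
    then show "int m dvd i + d * int (l*m+r) - (i' + d * int r)" by (simp add: algebra_simps)
  qed
  moreover have "E (d * int (Suc (l*m+r))) \<approx> E (d * int (Suc r))"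
    by (rule E_cg) (simp add: algebra_simps)
  moreover have u: "unit (E (d * int (Suc r)))" "unit (E (d * int (Suc (l*m+r))))"
  proof -
    have "\<not> m dvd Suc r" using Suc.prems by (simp add: nat_dvd_not_less)
    moreover have "\<not> m dvd Suc (l*m+r)"
      using \<open>\<not> m dvd Suc r\<close> by (metis add_Suc_right dvd_add_right_iff dvd_triv_right)
    ultimately show "unit (E (d * int (Suc r)))" "unit (E (d * int (Suc (l*m+r))))"
      using E_unit dvd_d_iff by blast+
  qed
  ultimately have "E (i + d * int (l*m+r)) / E (d * int (Suc (l*m+r))) \<approx> E (i' + d * int r) / E (d * int (Suc r))"
    using E_R by (intro cg_divide)
  then have "beta i (l*m+r) * (E (i + d * int (l*m+r)) / E (d * int (Suc (l*m+r))))
     \<approx> beta i (l*m) * beta i' r * (E (i' + d * int r) / E (d * int (Suc r)))"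
    using Suc beta_R E_R u by (intro cg_mult divide_R) auto
  then show ?case by (simp add: beta_Suc mult.assoc)
qed

section \<open>Antisymmetry modulo \<open>p\<close> and sums over blocks\<close>

lemma Q_root: "Q ^ Suc j \<noteq> 1"
  using E_nz[of "d * int (Suc j)"] d_pos by (simp del: of_nat_Suc add: E_Q[symmetric])

text \<open>Replacing \<open>q^t\<close> by \<open>\<plusminus> q^(-ds)\<close> makes the antisymmetry of the summand an exact identity in the field;
  the sign is needed because only \<open>q^(2(t+ds))\<close>, not \<open>q^(t+ds)\<close>, is known to be 1 modulo \<open>p\<close>.\<close>

lemma approx_parameter:
  assumes "int m dvd t + d * int s"
  obtains b where "b \<approx> q powi t" "b \<in> R" "b\<^sup>2 = q powi (2 * (- d * int s))" 
proof -
  let ?v = "q powi (t + d * int s)"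
  have "(?v - 1) * (?v + 1) = - E (t + d * int s)"
    by (simp add: E_def algebra_simps flip: power_int_add)
  then have "(?v - 1) * (?v + 1) \<in> I 1" using assms by (simp add: I_minus E_I)
  then have "?v - 1 \<in> I 1 \<or> ?v + 1 \<in> I 1"
    by (intro I_prime) (auto intro!: diff_R add_R powi_R one_R)
  then obtain c where c: "?v - c \<in> I 1" "c = 1 \<or> c = -1" by (metis diff_minus_eq_add)
  show ?thesis
  proof (rule that[of "c * q powi (- d * int s)"])
    have "q powi (- d * int s) * - (?v - c) \<in> I 1"
      by (intro I_multR(2) I_minus c(1) powi_R)
    then show "c * q powi (- d * int s) \<approx> q powi t" unfolding cg_def
      by (simp add: right_diff_distrib mult.commute flip: power_int_add)
    show "c * q powi (- d * int s) \<in> R" using c(2) by (auto intro!: minus_R powi_R)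
    show "(c * q powi (- d * int s))\<^sup>2 = q powi (2 * (- d * int s))"
      using c(2) by (auto simp: power_int_power' mult.commute)
  qed
qed

lemma wp_term_eq: "b\<^sup>2 = q powi (2*i) \<Longrightarrow> wp_term b Q k
    = (1 - q powi (2 * (i + 2 * (d * int k)))) * (1 - b * Q^k)\<^sup>2 * beta i k ^ 4 * q powi (2 * (- 2 * i * int k))"
proof -
  assume b: "b\<^sup>2 = q powi (2*i)"
  have 1: "b\<^sup>2 * (Q^k)\<^sup>2 = q powi (2 * (i + 2 * (d * int k)))"
    unfolding b Q_power by (simp add: power_int_power' distrib_left mult_ac flip: power_int_add)
  have "b ^ (4*k) = (b\<^sup>2) ^ (2*k)" by (simp flip: power_mult)
  also have "\<dots> = q powi (4 * i * int k)" unfolding b by (simp add: power_int_power' mult_ac)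
  finally have 2: "x / b ^ (4*k) = x * q powi (2 * (- 2 * i * int k))" for x
    by (simp add: field_simps power_int_minus)
  show ?thesis unfolding wp_term_def 1 2 by (simp add: b beta_def)
qed

lemma wp_term_R: "b\<^sup>2 = q powi (2*i) \<Longrightarrow> b \<in> R \<Longrightarrow> wp_term b Q k \<in> R"
  unfolding wp_term_eq by (intro R_intros powi_R beta_R unit_R[OF Q_unit])

text \<open>Each of the four factors \<open>beta i k\<close> contributes one factor
  \<open>p\<close>.\<close>

lemma wp_term_I4:
  "s < k mod m \<Longrightarrow> s < m \<Longrightarrow> int m dvd i + d * int s \<Longrightarrow> b\<^sup>2 = q powi (2*i) \<Longrightarrow> b \<in> R \<Longrightarrow> wp_term b Q k \<in> I 4"
  unfolding wp_term_eq using I_power[OF beta_I, of s k i 4]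
  by (intro I_multR R_intros powi_R unit_R[OF Q_unit]) auto

text \<open>Replacing \<open>t\<close> by \<open>- d s\<close> and dropping \<open>l*m\<close>
  changes the exponents of \<open>q^2\<close> by multiples of \<open>m\<close>, and
  \<open>beta_shift\<close> extracts the factor common to the block. The exact reflection applies to
  \<open>wp_term b Q r\<close>, as \<open>b^2 = Q^(-s)\<close>.\<close>

lemma wp_term_shift:
  assumes s: "s < m" "int m dvd t + d * int s" and r: "r \<le> s"
    and b: "b \<approx> q powi t" "b \<in> R" "b\<^sup>2 = q powi (2 * (- d * int s))"
  shows "wp_term (q powi t) Q (l*m+r) \<approx> beta t (l*m) ^ 4 * wp_term b Q r"
proof -
  have e: "(q powi t)\<^sup>2 = q powi (2*t)" by (simp add: power_int_power' mult.commute)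
  have 1: "1 - q powi (2 * (t + 2 * (d * int (l*m+r)))) \<approx> 1 - q powi (2 * (- d * int s + 2 * (d * int r)))"
  proof (intro cg_diff cg_refl powi_cg)
    have "int m dvd (t + d * int s) + int m * (2 * d * int l)" by (intro dvd_add[OF s(2)]) auto
    then show "int m dvd t + 2 * (d * int (l*m+r)) - (- d * int s + 2 * (d * int r))" by (simp add: algebra_simps)
  qed
  have *: "q powi t * Q ^ (l*m+r) \<approx> b * Q ^ r"
    unfolding Q_power by (intro cg_mult cg_sym[OF b(1)] powi_cg powi_R) (simp add: algebra_simps)
  have 2: "(1 - q powi t * Q ^ (l*m+r))\<^sup>2 \<approx> (1 - b * Q ^ r)\<^sup>2"
    by (intro cg_power cg_diff cg_refl * R_intros powi_R unit_R[OF Q_unit])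
  have 3: "beta t (l*m+r) ^ 4 \<approx> (beta t (l*m) * beta (- d * int s) r) ^ 4"
    by (intro cg_power beta_R beta_shift) (use s r in auto)
  have "int m dvd -2 * (t * int l) * int m - 2 * int r * (t + d * int s)"
    using s(2) by (intro dvd_diff dvd_mult) auto
  also have "-2 * (t * int l) * int m - 2 * int r * (t + d * int s)
     = - 2 * t * int (l*m+r) - - 2 * (- d * int s) * int r" by (simp add: algebra_simps)
  finally have 4: "q powi (2 * (- 2 * t * int (l*m+r))) \<approx> q powi (2 * (- 2 * (- d * int s) * int r))"
    by (rule powi_cg)
  have "wp_term (q powi t) Q (l*m+r) \<approx>
    (1 - q powi (2 * (- d * int s + 2 * (d * int r)))) * (1 - b * Q ^ r)\<^sup>2 * (beta t (l*m) * beta (- d * int s) r) ^ 4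
     * q powi (2 * (- 2 * (- d * int s) * int r))"
    unfolding wp_term_eq[OF e] by (intro cg_mult 1 2 3 4 R_intros powi_R beta_R unit_R[OF Q_unit] b(2))
  then show ?thesis unfolding wp_term_eq[OF b(3)] by (simp add: power_mult_distrib mult_ac)
qed

lemma reflected_sum_zero:
  assumes "b\<^sup>2 = q powi (2 * (- d * int s))" "\<And>r. r \<le> s \<Longrightarrow> g (s - r) = g r"
  shows "(\<Sum>r\<le>s. wp_term b Q r * g r) = 0"
proof (rule wp_term_symmetric_sum)
  show "b\<^sup>2 * Q ^ s = 1" unfolding assms(1) Q_power by (simp flip: power_int_add)
qed (use assms unit_nz[OF two_unit] Q_root in auto)

lemma block_sum:
  assumes s: "s < m" "int m dvd t + d * int s"
  shows "(\<Sum>r\<le>s. wp_term (q powi t) Q (l*m+r)) \<in> I 1"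
proof -
  obtain b where b: "b \<approx> q powi t" "b \<in> R" "b\<^sup>2 = q powi (2 * (- d * int s))"
    using approx_parameter[OF s(2)] .
  have "(\<Sum>r\<le>s. wp_term (q powi t) Q (l*m+r)) \<approx> (\<Sum>r\<le>s. beta t (l*m) ^ 4 * wp_term b Q r)"
    using s b by (intro cg_sum wp_term_shift) auto
  also have "(\<Sum>r\<le>s. beta t (l*m) ^ 4 * wp_term b Q r) = 0"
    using reflected_sum_zero[OF b(3), of "\<lambda>_. 1"] by (simp flip: sum_distrib_left)
  finally show ?thesis using cg_I I_zero by blast
qed

lemma powi_sq: "(q powi t)\<^sup>2 = q powi (2*t)" by (simp add: power_int_power' mult.commute)

lemma full_block_sum:
  assumes s: "s < m" "int m dvd t + d * int s"
  shows "(\<Sum>r<m. wp_term (q powi t) Q (l*m+r)) \<in> I 1"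
proof -
  have "{..<m} = {..s} \<union> {s<..<m}" using s(1) by auto
  then have "(\<Sum>r<m. wp_term (q powi t) Q (l*m+r)) =
     (\<Sum>r\<le>s. wp_term (q powi t) Q (l*m+r)) + (\<Sum>r\<in>{s<..<m}. wp_term (q powi t) Q (l*m+r))"
    by (simp add: sum.union_disjoint[symmetric] ivl_disj_int)
  moreover have "(\<Sum>r\<in>{s<..<m}. wp_term (q powi t) Q (l*m+r)) \<in> I 1"
    by (intro I_sum I_mono[of 1 4] wp_term_I4[OF _ s powi_sq powi_R]) auto
  ultimately show ?thesis using block_sum[OF s] I_add by simp
qed

lemma full_blocks_sum:
  "(\<Sum>k<l*m. wp_term (q powi t) Q k) \<in> I 1"
proof -
  obtain s where s: "s < m" "int m dvd t + d * int s" using ex_zero by blast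
  have "(\<Sum>k<l*m. wp_term (q powi t) Q k) = (\<Sum>i<l. \<Sum>r<m. wp_term (q powi t) Q (i*m+r))"
  proof -
    have "(\<Sum>k\<in>{i*m..<i*m+m}. f k) = (\<Sum>r<m. f (i*m+r))" for i and f :: "nat \<Rightarrow> 'a"
      using sum.shift_bounds_nat_ivl[of f 0 "i*m" m] by (simp add: atLeast0LessThan add.commute)
    then show ?thesis by (simp flip: sum.nat_group)
  qed
  then show ?thesis using full_block_sum[OF s] by (simp only: I_sum)
qed

text \<open>\<open>N\<close> and \<open>s = N mod m\<close> solve the same congruence, so the range
  consists of full blocks followed by the part \<open>r \<le> s\<close> of one more block, which
  \<open>block_sum\<close> covers.\<close>

lemma truncated_sum:
  assumes "int m dvd t + d * int N"
  shows "(\<Sum>k\<le>N. wp_term (q powi t) Q k) \<in> I 1"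
proof -
  define l s where "l = N div m" and "s = N mod m"
  have N: "N = l*m+s" by (simp add: l_def s_def)
  have s: "s < m" using m_pos by (simp add: s_def)
  have "int m dvd t + d * int s" using dvd_shift_iff[OF assms, of s] by (simp add: s_def)
  moreover have "(\<Sum>k\<le>N. wp_term (q powi t) Q k) = (\<Sum>k<l*m. wp_term (q powi t) Q k) + (\<Sum>r\<le>s. wp_term (q powi t) Q (l*m+r))"
  proof -
    have "{..N} = {..<l*m} \<union> {l*m+0..l*m+s}" using N by auto
    moreover have "(\<Sum>k\<in>{l*m+0..l*m+s}. f k) = (\<Sum>r\<le>s. f (l*m+r))" for f :: "nat \<Rightarrow> 'a"
      using sum.shift_bounds_cl_nat_ivl[of f 0 "l*m" s] by (simp add: atLeast0AtMost add.commute)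
    moreover have "{..<l*m} \<inter> {l*m+0..l*m+s} = {}" by auto
    ultimately show ?thesis by (simp add: sum.union_disjoint)
  qed
  ultimately show ?thesis using full_blocks_sum block_sum[OF s] I_add by simp
qed

end

section \<open>The right-hand side and the congruence modulo \<open>p^3\<close>\<close>

context cyclotomic_subring begin

text \<open>The right-hand side of the theorem, scaled by \<open>(1 - q^2) (1 - q)^2\<close> like
  \<open>wp_term\<close>. The denominator \<open>1 + q^(2t)\<close> is grouped with the Pochhammer
  quotient, because it is this combination that is shown to lie in \<open>R\<close>.\<close>

definition rhs where "rhs t N n = - 2 * (1 - q powi t)\<^sup>2 * (1 - q powi (2*n))
    * (qpochhammer (q powi (4*t)) Q N / ((1 + q powi (2*t)) * qpochhammer Q Q N)) * q powi (t - 2 * t * int N)"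

lemma one_plus_nz: "1 + q powi (2*t) \<noteq> 0"
proof
  assume "1 + q powi (2*t) = 0"
  then have *: "q powi (2*t) = -1" by (metis add_eq_0_iff)
  then have "q powi (4*t) = 1" using power_int_power'[of q "2*t" 2] by simp
  then have "t = 0" using nonroot by fastforce
  then show False using * unit_nz[OF two_unit] by (simp add: eq_neg_iff_add_eq_0)
qed

text \<open>If \<open>N = 0\<close>, then \<open>m\<close> divides \<open>t\<close> and
  \<open>1 + q^(2t)\<close> is congruent to the unit 2. Otherwise \<open>1 + q^(2t)\<close> cancels
  against \<open>1 - q^(4t)\<close>, which leaves a \<open>beta\<close> times
  \<open>E t / E (d * int N)\<close>; if \<open>p\<close> divides this denominator, then
  \<open>m\<close> divides \<open>d N\<close> and \<open>n\<close>, hence \<open>t\<close>, so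
  \<open>p\<close> divides \<open>E t\<close> too.\<close>

lemma rhs_quotient_R:
  assumes tN: "t + d * int N = n" and mn: "int m dvd n"
  shows "qpochhammer (q powi (4*t)) Q N / ((1 + q powi (2*t)) * qpochhammer Q Q N) \<in> R"
proof (cases N)
  case 0
  then have "E t \<in> I 1" using tN mn by (simp add: E_I)
  then have "2 \<approx> 1 + q powi (2*t)" by (simp add: cg_def E_def)
  then have "unit (1 + q powi (2*t))" using cg_unit two_unit by blast
  then show ?thesis using 0 by (simp add: divide_R one_R)
next
  case (Suc M)
  have "1 - q powi (4*t) = E t * (1 + q powi (2*t))"
    by (simp add: E_def algebra_simps flip: power_int_add)
  moreover have "q powi (4*t) * Q = q powi (2 * (2*t+d))"
    by (simp add: Q_def algebra_simps flip: power_int_add)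
  ultimately have "qpochhammer (q powi (4*t)) Q N / ((1 + q powi (2*t)) * qpochhammer Q Q N)
      = beta (2*t+d) M * (E t / E (d * int N))"
    unfolding Suc qpochhammer_shift[of "q powi (4*t)"] qpochhammer_Suc[of Q] E_Q beta_def
    using one_plus_nz by simp
  moreover have "E t / E (d * int N) \<in> R"
  proof (cases "int m dvd d * int N")
    case True
    then have "E t \<in> I 1" using tN mn dvd_add_left_iff unfolding E_I by blast
    then show ?thesis using Suc d_pos by (intro divide_E_R) auto
  qed (auto intro: divide_R E_R E_unit)
  ultimately show ?thesis using mult_R[OF beta_R[of "2*t+d" M]] by (simp only:)
qed

lemma rhs_I1:
  assumes "t + d * int N = n" "int m dvd n"
  shows "rhs t N n \<in> I 1"
proof -
  have "1 - q powi (2*n) \<in> I 1" using assms by (simp add: ord)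
  then show ?thesis unfolding rhs_def
    by (intro I_multR(1) rhs_quotient_R[OF assms] powi_R I_multR(2)[of "- 2 * (1 - q powi t)\<^sup>2"] R_intros)
qed

lemma not_dvd_m: "\<not> d dvd int m"
  using dm d_ge by (metis coprime_common_divisor dvd_refl zdvd_not_zless zero_less_one not_le one_less_numeral_iff order_less_le_trans semiring_norm(76))

text \<open>In the closed form, the part \<open>- 2 b (1 - b)^2\<close> of the last factor
  reproduces \<open>rhs\<close>. The other part, \<open>a (1 - y)^2/y\<close>, leaves
  \<open>(1 - y)^3\<close> times an element of \<open>R\<close>, and \<open>p\<close> divides
  \<open>1 - y\<close>.\<close>

lemma deformed_sum:
  assumes tN: "t + d * int N = int m"
  defines "a \<equiv> q powi (2*t)" and "b \<equiv> q powi t" and "y \<equiv> q powi (2 * int m)"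
  shows "(\<Sum>k\<le>N. (1 - a * Q ^ (2*k)) * (1 - b * Q^k)\<^sup>2 * (beta t k)\<^sup>2
             * (qpochhammer (a*y) Q k * qpochhammer (a/y) Q k / (qpochhammer (Q*y) Q k * qpochhammer (Q/y) Q k))
             / a ^ (2*k)) - rhs t N (int m) \<in> I 3"
proof -
  have ab: "a = b\<^sup>2" by (simp add: a_def b_def powi_sq)
  have y: "y = a * Q ^ N" unfolding y_def a_def Q_power tN[symmetric]
    by (simp add: distrib_left flip: power_int_add)
  \<comment> \<open>\<open>d\<close> divides neither \<open>t\<close> nor \<open>m\<close>, so
    \<open>t + d j\<close> and \<open>m - d j\<close> are never 0; this verifies the nonvanishing
    conditions of the closed form.\<close>
  have nd: "\<not> d dvd t" using not_dvd_m unfolding tN[symmetric] by (metis dvd_add_left_iff dvd_triv_left)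
  have aQ: "a * Q ^ j \<noteq> 1" for j
  proof -
    have "t + d * int j \<noteq> 0" using nd by (metis add_eq_0_iff dvd_minus_iff dvd_triv_left)
    from E_nz[OF this] show ?thesis by (simp add: a_def flip: E_shift)
  qed
  have Qy: "Q ^ j \<noteq> y" for j
  proof
    assume "Q ^ j = y"
    then have "q powi (2 * (d * int j) - 2 * int m) = 1"
      unfolding Q_power y_def by (simp add: power_int_diff)
    then have "int m = d * int j" using nonroot by fastforce
    then show False using not_dvd_m by simp
  qed
  have a1: "a \<noteq> -1" using one_plus_nz[of t] by (auto simp: a_def)
  have bnz: "b \<noteq> 0" by (simp add: b_def)
  define H where "H = qpochhammer (q powi (4*t)) Q N / ((1 + q powi (2*t)) * qpochhammer Q Q N)"
  have HR: "H \<in> R" unfolding H_def by (rule rhs_quotient_R[OF tN]) simp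
  have a2: "a\<^sup>2 = q powi (4*t)" by (simp add: a_def power_int_power')
  have yI: "1 - y \<in> I 1" by (simp add: y_def ord)
  have u: "unit y" "unit a" by (simp_all add: y_def a_def powi_unit)
  have "(\<Sum>k\<le>N. (1 - a * Q ^ (2*k)) * (1 - b * Q^k)\<^sup>2 * (beta t k)\<^sup>2
             * (qpochhammer (a*y) Q k * qpochhammer (a/y) Q k / (qpochhammer (Q*y) Q k * qpochhammer (Q/y) Q k))
             / a ^ (2*k))
     = (1 - y) * qpochhammer (a\<^sup>2) Q N / (a ^ N * qpochhammer Q Q N * (1 + a)) * (a * (1 + y)\<^sup>2 / y - 2 * b * (1 + a))"
    using deformed_sum_closed_form[of Q b y N, folded ab, OF Q_nz bnz a1 Q_root aQ y Qy]
    by (simp add: beta_def a_def)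
  also have "\<dots> = (1 - y) * H / a ^ N * (a * (1 + y)\<^sup>2 / y - 2 * b * (1 + a))"
    unfolding H_def a2 by (simp add: a_def mult_ac)
  finally have 1: "(\<Sum>k\<le>N. (1 - a * Q ^ (2*k)) * (1 - b * Q^k)\<^sup>2 * (beta t k)\<^sup>2
             * (qpochhammer (a*y) Q k * qpochhammer (a/y) Q k / (qpochhammer (Q*y) Q k * qpochhammer (Q/y) Q k))
             / a ^ (2*k)) = \<dots>" .
  have "q powi (t - 2 * t * int N) = b / a ^ N"
    by (simp add: a_def b_def power_int_power' power_int_diff)
  then have 2: "rhs t N (int m) = - 2 * (1 - b)\<^sup>2 * (1 - y) * H * (b / a ^ N)"
    unfolding rhs_def H_def b_def y_def by simp
  have "(1 - y) * H / a ^ N * (a * (1 + y)\<^sup>2 / y - 2 * b * (1 + a)) - rhs t N (int m)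
     = (1 - y) ^ 3 * (H * a / (a ^ N * y))"
    unfolding 2 ab using unit_nz[OF u(1)] bnz by (simp add: field_simps power3_eq_cube power2_eq_square)
  moreover have "(1 - y) ^ 3 \<in> I 3" using I_power[OF yI, of 3] by simp
  ultimately show ?thesis unfolding 1
    using HR u by (simp only:) (intro I_multR(1) R_intros unit_mult unit_power, auto simp: unit_R)
qed

text \<open>\<open>c k\<close> is the original summand and \<open>X k * \<rho> k\<close> the
  deformed one. Up to multiples of \<open>w^2\<close> they differ by \<open>w * c k * e k\<close>.
  As \<open>w\<close> lies in \<open>I 2\<close>, it suffices that the sum of the
  \<open>c k * e k\<close> lies in \<open>I 1\<close>.\<close>

lemma cubic_congruence:
  assumes tN: "t + d * int N = int m" and N: "N < m"
  shows "(\<Sum>k\<le>N. wp_term (q powi t) Q k) - rhs t N (int m) \<in> I 3"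
proof -
  define a b y where "a = q powi (2*t)" and "b = q powi t" and "y = q powi (2 * int m)"
  define w where "w = (1 - y)\<^sup>2 / y"
  \<comment> \<open>\<open>\<phi> x\<close> is the first-order coefficient contributed by a factor
    \<open>(1 - x)^2 - w x\<close>, up to sign; it is invariant under
    \<open>x |-> 1/x\<close>.\<close>
  define \<phi> where "\<phi> x = x / (1 - x)\<^sup>2" for x :: 'a
  define A B C D where "A j = (1 - a * Q^j)\<^sup>2" and "B j = a * Q^j" and "C j = (1 - Q * Q^j)\<^sup>2" and "D j = Q * Q^j"
    for j :: nat
  define e where "e k = (\<Sum>j<k. \<phi> (a * Q^j) - \<phi> (Q * Q^j))" for k
  \<comment> \<open>\<open>e\<close> with \<open>a\<close> replaced by \<open>1 / Q^N\<close>: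
    congruent to \<open>e\<close> modulo \<open>p\<close>, and exactly symmetric under
    \<open>k |-> N - k\<close>.\<close>
  define e' where "e' k = (\<Sum>j<k. \<phi> (Q^j / Q^N) - \<phi> (Q * Q^j))" for k
  define X where "X k = (1 - a * Q ^ (2*k)) * (1 - b * Q^k)\<^sup>2 * (beta t k)\<^sup>2 / a ^ (2*k)" for k
  define \<rho> where "\<rho> k = qpochhammer (a*y) Q k * qpochhammer (a/y) Q k / (qpochhammer (Q*y) Q k * qpochhammer (Q/y) Q k)" for k
  define c where "c = wp_term b Q"
  have dvdN: "int m dvd t + d * int N" using tN by simp
  have u: "unit y" "unit a" "unit b" by (simp_all add: y_def a_def b_def powi_unit)
  have nz: "y \<noteq> 0" "a \<noteq> 0" "b \<noteq> 0" using u unit_nz by auto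
  have ab: "a = b\<^sup>2" by (simp add: a_def b_def powi_sq)
  have w: "w \<in> I 2"
    using I_power[of "1 - y" 1 2] u(1) unfolding w_def by (intro I_divide) (simp_all add: y_def ord)
  have unit_aQ: "unit (1 - a * Q^j)" if "j < N" for j
    unfolding a_def E_shift by (rule E_unit) (use dvd_shift_iff[OF dvdN, of j] that N in simp)
  have unit_QQ: "unit (1 - Q * Q^j)" if "j < N" for j
    unfolding E_Q by (rule E_unit, unfold dvd_d_iff) (use that N in \<open>simp add: nat_dvd_not_less\<close>)
  have unit_QN: "unit (1 - Q^j / Q^N)" if "j < N" for j
  proof -
    have "1 - Q^j / Q^N = E (- d * int N + d * int j)"
      unfolding E_shift[symmetric] by (simp add: Q_power power_int_minus field_simps)
    moreover have "\<not> int m dvd - d * int N + d * int j"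
      using dvd_shift_iff[of "- d * int N" N j] that N by simp
    ultimately show ?thesis using E_unit by simp
  qed
  have QR: "Q \<in> R" using Q_unit unit_R by blast
  have cX: "c k = X k * (beta t k)\<^sup>2" for k
  proof -
    have "b ^ (4*k) = a ^ (2*k)" unfolding ab by (simp flip: power_mult)
    moreover have "(Q^k)\<^sup>2 = Q^(2*k)" by (simp add: mult.commute flip: power_mult)
    moreover have "qpochhammer (b\<^sup>2) Q k / qpochhammer Q Q k = beta t k" by (simp add: beta_def b_def powi_sq)
    moreover have "x * z ^ 4 / v = x * z\<^sup>2 / v * z\<^sup>2" for x z v :: 'a
      by (simp add: power4_eq_xxxx power2_eq_square)
    ultimately show ?thesis unfolding c_def wp_term_def X_def ab[symmetric] by (simp only:)
  qed
  have XR: "X k \<in> R" for k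
    unfolding X_def using u QR by (intro R_intros beta_R unit_power) (auto simp: unit_R)
  have rho: "\<rho> k = (\<Prod>j<k. (A j - w * B j) / (C j - w * D j))" for k
  proof -
    \<comment> \<open>Pairing the factors for \<open>y\<close> and \<open>1/y\<close> leaves a
      dependence on \<open>w\<close> alone.\<close>
    have "(1 - v * y * x) * (1 - v / y * x) = (1 - v * x)\<^sup>2 - w * (v * x)" for v x
      unfolding w_def using nz by (simp add: field_simps power2_eq_square)
    then show ?thesis unfolding \<rho>_def qpochhammer_def A_def B_def C_def D_def
      by (simp only: prod.distrib[symmetric] prod_dividef)
  qed
  have pert: "\<rho> k - (beta t k)\<^sup>2 * (1 - w * e k) \<in> I 4" if k: "k \<le> N" for k
  proof -
    have "(\<Prod>j<k. A j / C j) = (beta t k)\<^sup>2"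
      unfolding A_def C_def beta_def qpochhammer_def a_def
      by (simp add: prod_dividef power_divide prod_power_distrib)
    moreover have "(\<Sum>j<k. B j / A j - D j / C j) = e k"
      by (simp add: e_def A_def B_def C_def D_def \<phi>_def)
    moreover have "(\<Prod>j<k. (A j - w * B j) / (C j - w * D j))
       - (\<Prod>j<k. A j / C j) * (1 - w * (\<Sum>j<k. B j / A j - D j / C j)) \<in> I (2 * 2)"
      by (rule perturbed_quotient_prod[OF w])
        (use k u QR in \<open>auto simp: A_def B_def C_def D_def unit_R intro!: unit_power unit_aQ unit_QQ mult_R power_R\<close>)
    ultimately show ?thesis unfolding rho by simp
  qed
  have "(\<Sum>k\<le>N. c k * e k) \<in> I 1"
  proof -
    obtain b' where b': "b' \<approx> q powi t" "b' \<in> R" "b'\<^sup>2 = q powi (2 * (- d * int N))"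
      using approx_parameter[OF dvdN] .
    have cc: "c k \<approx> wp_term b' Q k" if "k \<le> N" for k
      using wp_term_shift[OF N dvdN that b', of 0] by (simp add: c_def b_def)
    have aN: "a \<approx> 1 / Q^N"
    proof -
      have "q powi (2*t) \<approx> q powi (2 * (- d * int N))" by (rule powi_cg) (use dvdN in simp)
      then show ?thesis by (simp add: a_def Q_power power_int_minus divide_inverse)
    qed
    have phi_cg: "\<phi> (a * Q^j) \<approx> \<phi> (Q^j / Q^N)" if "j < N" for j
    proof -
      have "a * Q^j \<approx> 1 / Q^N * Q^j" using u QR by (intro cg_mult aN cg_refl power_R) (auto simp: unit_R)
      then have *: "a * Q^j \<approx> Q^j / Q^N" by simp
      show ?thesis unfolding \<phi>_def using u QR unit_aQ[OF that]
        by (intro cg_divide * cg_power cg_diff cg_refl R_intros unit_power) (auto simp: unit_R)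
    qed
    have eR: "e k \<in> R" "e' k \<in> R" if "k \<le> N" for k
      unfolding e_def e'_def \<phi>_def using that u QR unit_aQ unit_QQ unit_QN Q_unit
      by (auto intro!: sum_R R_intros unit_power unit_mult simp: unit_R)
    have ee: "e k \<approx> e' k" if "k \<le> N" for k
      unfolding e_def e'_def using that by (intro cg_sum cg_diff cg_refl phi_cg) auto
    have "(\<Sum>k\<le>N. c k * e k) \<approx> (\<Sum>k\<le>N. wp_term b' Q k * e' k)"
    proof (intro cg_sum cg_mult cc ee)
      show "c k \<in> R" for k unfolding c_def b_def by (intro wp_term_R[OF powi_sq] powi_R)
    qed (use eR in auto)
    also have "(\<Sum>k\<le>N. wp_term b' Q k * e' k) = 0"
    proof (rule reflected_sum_zero[OF b'(3)])
      fix r assume r: "r \<le> N"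
      define \<Phi> where "\<Phi> k = (\<Sum>j<k. \<phi> (Q * Q^j))" for k
      \<comment> \<open>Since \<open>\<phi> (1/x) = \<phi> x\<close>, the first sum in
        \<open>e'\<close> runs over the last \<open>k\<close> terms of \<open>\<Phi> N\<close>; the
        resulting formula is visibly symmetric.\<close>
      have e'_eq: "e' k = \<Phi> N - \<Phi> (N - k) - \<Phi> k" if k: "k \<le> N" for k
      proof -
        have "(\<Sum>j<k. \<phi> (Q^j / Q^N)) = \<Phi> N - \<Phi> (N - k)" using k
        proof (induction k)
          case (Suc k)
          have inv: "\<phi> (1 / x) = \<phi> x" if "x \<noteq> 0" for x
            unfolding \<phi>_def using that by (simp add: field_simps power2_eq_square)
          have 1: "N - k = Suc (N - Suc k)" using Suc by simp
          have "N = k + Suc (N - Suc k)" using Suc by simp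
          then have "Q ^ N = Q^k * Q ^ Suc (N - Suc k)" by (metis power_add)
          then have "Q^k / Q^N = 1 / (Q * Q ^ (N - Suc k))" by (simp add: field_simps)
          then have "\<phi> (Q^k / Q^N) = \<phi> (Q * Q ^ (N - Suc k))" using inv by simp
          then show ?case using Suc by (simp add: 1 \<Phi>_def)
        qed simp
        then show ?thesis by (simp add: e'_def \<Phi>_def sum_subtractf)
      qed
      show "e' (N - r) = e' r" using r by (simp add: e'_eq)
    qed
    finally show ?thesis using cg_I I_zero by blast
  qed
  then have "w * (\<Sum>k\<le>N. c k * e k) \<in> I 3" using I_mult[OF w] by fastforce
  moreover have "(\<Sum>k\<le>N. X k * (\<rho> k - (beta t k)\<^sup>2 * (1 - w * e k))) \<in> I 3"
    by (intro I_sum I_mono[of 3 4] I_multR(2) XR pert) auto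
  moreover have "(\<Sum>k\<le>N. X k * \<rho> k) - rhs t N (int m) \<in> I 3"
    using deformed_sum[OF tN] by (simp add: X_def \<rho>_def a_def b_def y_def mult_ac)
  ultimately have "((\<Sum>k\<le>N. X k * \<rho> k) - rhs t N (int m)) - (\<Sum>k\<le>N. X k * (\<rho> k - (beta t k)\<^sup>2 * (1 - w * e k)))
      + w * (\<Sum>k\<le>N. c k * e k) \<in> I 3" by (simp only: I_add I_diff)
  moreover have "((\<Sum>k\<le>N. X k * \<rho> k) - rhs t N (int m)) - (\<Sum>k\<le>N. X k * (\<rho> k - (beta t k)\<^sup>2 * (1 - w * e k)))
      + w * (\<Sum>k\<le>N. c k * e k) = (\<Sum>k\<le>N. c k) - rhs t N (int m)"
  proof -
    have "(\<Sum>k\<le>N. c k) = (\<Sum>k\<le>N. X k * \<rho> k) - (\<Sum>k\<le>N. X k * (\<rho> k - (beta t k)\<^sup>2 * (1 - w * e k)))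
      + w * (\<Sum>k\<le>N. c k * e k)"
      unfolding sum_distrib_left sum_subtractf[symmetric] sum.distrib[symmetric]
      by (rule sum.cong[OF refl]) (simp add: cX algebra_simps)
    then show ?thesis by simp
  qed
  ultimately have "(\<Sum>k\<le>N. c k) - rhs t N (int m) \<in> I 3" by (simp only:)
  then show ?thesis by (simp add: c_def b_def)
qed

text \<open>Here \<open>N\<close> is the zero position of the only block, so the terms with
  \<open>N < k < m\<close> even lie in \<open>I 4\<close>.\<close>

lemma tail_terms:
  assumes tN: "t + d * int N = int m" and N: "N < m"
  shows "(\<Sum>k<m. wp_term (q powi t) Q k) - (\<Sum>k\<le>N. wp_term (q powi t) Q k) \<in> I 3"
proof -
  have "{..<m} = {..N} \<union> {N<..<m}" using N by auto
  then have "(\<Sum>k<m. wp_term (q powi t) Q k) - (\<Sum>k\<le>N. wp_term (q powi t) Q k) = (\<Sum>k\<in>{N<..<m}. wp_term (q powi t) Q k)"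
    by (simp add: sum.union_disjoint ivl_disj_int)
  also have "\<dots> \<in> I 3"
    by (intro I_sum I_mono[of 3 4] wp_term_I4[OF _ N _ powi_sq powi_R]) (use tN in auto)
  finally show ?thesis .
qed

end

subsection \<open>Cyclotomic polynomials and localizations\<close>

declare cyclo.simps [simp del]

section \<open>Orders modulo a prime and squarefreeness of \<open>x^k - 1\<close>\<close>

lemma prime_elem_power_order:
  fixes r y :: "'a::idom"
  assumes r: "prime_elem r" and e: "e > 0" "r dvd y ^ e - 1"
  obtains m :: nat where "m > 0" "\<And>j. r dvd y ^ j - 1 \<longleftrightarrow> m dvd j"
proof -
  define m where "m = (LEAST j. j > 0 \<and> r dvd y ^ j - 1)"
  have m: "m > 0 \<and> r dvd y ^ m - 1" unfolding m_def by (rule LeastI[of _ e]) (use e in simp)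
  have least: "m \<le> j" if "j > 0" "r dvd y ^ j - 1" for j
    unfolding m_def by (rule Least_le) (use that in simp)
  have pow: "r dvd y ^ (m * l) - 1" for l
  proof -
    have "y ^ m - 1 dvd (y ^ m) ^ l - 1" unfolding power_diff_1_eq[of "y ^ m" l] by simp
    then show ?thesis using m by (simp add: power_mult) (blast intro: dvd_trans)
  qed
  have "r dvd y ^ j - 1 \<longleftrightarrow> m dvd j" for j
  proof
    assume j: "r dvd y ^ j - 1"
    define l s where "l = j div m" and "s = j mod m"
    have "y ^ j = y ^ (m * l) * y ^ s" by (simp add: l_def s_def flip: power_add)
    then have "y ^ s - 1 = (y ^ j - 1) - (y ^ (m * l) - 1) * y ^ s" by (simp add: algebra_simps)
    then have "r dvd y ^ s - 1" using j pow[of l] by (simp only: dvd_diff dvd_mult2)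
    moreover have "s < m" using m by (simp add: s_def)
    ultimately have "s = 0" using least[of s] by fastforce
    then show "m dvd j" by (auto simp: s_def)
  next
    assume "m dvd j"
    then show "r dvd y ^ j - 1" using pow by (auto simp: dvd_def)
  qed
  with m show ?thesis using that by blast
qed

lemma prime_elem_not_dvd_of_nat:
  fixes p :: "rat poly"
  assumes "prime_elem p" "k > 0"
  shows "\<not> p dvd of_nat k"
proof
  assume "p dvd of_nat k"
  moreover have "is_unit (of_nat k :: rat poly)" using assms(2) by (simp add: of_nat_poly is_unit_const_poly_iff dvd_field_iff)
  ultimately show False using assms(1) by (meson dvd_trans prime_elem_not_unit)
qed

text \<open>A double factor \<open>p\<close> divides the derivative \<open>k x^(k-1)\<close> as
  well, hence \<open>x^k\<close>, and together with \<open>x^k - 1\<close> it divides 1.\<close>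

lemma prime_elem_square_not_dvd:
  fixes p :: "rat poly"
  assumes p: "prime_elem p" and k: "k > 0"
  shows "\<not> p * p dvd monom 1 k - 1"
proof
  assume "p * p dvd monom 1 k - 1"
  then obtain c where c: "monom 1 k - 1 = p * p * c" by (elim dvdE)
  have "pderiv (monom 1 k - 1 :: rat poly) = of_nat k * monom 1 (k - 1)"
    by (simp add: pderiv_diff pderiv_monom of_nat_poly smult_monom)
  moreover have "p dvd pderiv (monom 1 k - 1)" unfolding c by (simp add: pderiv_mult)
  ultimately have "p dvd monom 1 (k - 1)"
    using prime_elem_not_dvd_of_nat[OF p k] prime_elem_dvd_multD[OF p] by metis
  then have "p dvd monom 1 (k - 1) * monom 1 1" by simp
  then have "p dvd monom 1 k" using k by (simp add: mult_monom)
  moreover have "p dvd monom 1 k - 1" unfolding c by simp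
  ultimately have "p dvd monom 1 k - (monom 1 k - 1)" by (rule dvd_diff)
  then show False using p by (simp add: prime_elem_def)
qed

lemma monom_nz: "k > 0 \<Longrightarrow> monom 1 k - 1 \<noteq> (0 :: rat poly)"
  by (metis coeff_monom eq_iff_diff_eq_0 lead_coeff_1 degree_1 degree_monom_eq less_numeral_extra(3) zero_neq_one)

text \<open>The order of \<open>x\<close> modulo \<open>r\<close> divides both exponents, hence
  their gcd.\<close>

lemma monom_gcd_dvd:
  fixes r :: "rat poly"
  assumes r: "prime_elem r" and e: "e > 0" "r dvd monom 1 e - 1" "r dvd monom 1 f - 1"
  shows "r dvd monom 1 (gcd e f) - 1"
proof -
  have X: "monom 1 j = (monom 1 1 :: rat poly) ^ j" for j by (simp add: monom_power)
  obtain m where "\<And>j. r dvd (monom 1 1) ^ j - 1 \<longleftrightarrow> m dvd j"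
    using prime_elem_power_order[OF r e(1)] e(2) unfolding X[of e] by metis
  then show ?thesis using e(2,3) unfolding X[of e] X[of f] X[of "gcd e f"] by simp
qed

section \<open>Factorization of \<open>x^n - 1\<close> into cyclotomic polynomials\<close>

lemma prod_dvd_of_pairwise_coprime:
  fixes f :: "nat \<Rightarrow> rat poly"
  assumes "finite A" "\<And>i. i \<in> A \<Longrightarrow> f i dvd c" "\<And>i j. i \<in> A \<Longrightarrow> j \<in> A \<Longrightarrow> i \<noteq> j \<Longrightarrow> coprime (f i) (f j)"
  shows "prod f A dvd c"
  using assms
proof (induction A rule: finite_induct)
  case (insert a A)
  have "coprime (f a) (prod f A)" using insert by (intro prod_coprime_right[of A "f a" f]) auto
  then show ?case using insert by (auto intro!: divides_mult)
qed simp

text \<open>\<open>cyclo\<close> is defined through \<open>div\<close>, so the point is that this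
  division is exact: the factors for the proper divisors of \<open>n\<close> divide
  \<open>x^n - 1\<close> and are pairwise coprime.\<close>

lemma prod_cyclo: "n > 0 \<Longrightarrow> (\<Prod>e | e dvd n. cyclo e) = monom 1 n - 1"
proof (induction n rule: less_induct)
  case (less n)
  define A where "A = {e. e dvd n \<and> e < n}"
  have A: "finite A" "\<And>e. e \<in> A \<Longrightarrow> e > 0 \<and> e < n \<and> e dvd n"
    using less.prems by (auto simp: A_def intro: gr0I)
  have lower: "cyclo e * (monom 1 g - 1) dvd monom 1 e - 1" if "e \<in> A" "g dvd e" "g < e" for e g
  proof -
    have e: "e > 0" "e < n" using A that by auto
    have "g > 0" using that e by (auto intro: gr0I)
    then have "cyclo e * (monom 1 g - 1) = (\<Prod>i\<in>insert e {i. i dvd g}. cyclo i)"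
      using less.IH[of g] that e by (subst prod.insert) (auto dest: dvd_imp_le)
    also have "\<dots> dvd (\<Prod>i | i dvd e. cyclo i)"
      using that e by (intro prod_dvd_prod_subset) (auto intro: dvd_trans)
    finally show ?thesis using less.IH[of e] e by simp
  qed
  have cyclo_dvd: "cyclo e dvd monom 1 e - 1" if "e \<in> A" for e
    using less.IH[of e] A(2)[OF that] dvd_prodI[of "{i. i dvd e}" e cyclo] by simp
  have cyclo_dvd_n: "cyclo e dvd monom 1 n - 1" if e: "e \<in> A" for e
  proof -
    obtain l where l: "n = e * l" using A(2)[OF e] by (elim conjE dvdE)
    have "monom 1 n = (monom (1::rat) e) ^ l" by (simp add: monom_power l mult.commute)
    then have "monom 1 e - 1 dvd monom 1 n - (1 :: rat poly)" by (simp add: power_diff_1_eq)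
    then show ?thesis using cyclo_dvd[OF e] dvd_trans by blast
  qed
  \<comment> \<open>With \<open>g = gcd e f\<close>, a common prime factor \<open>r\<close> divides
    \<open>x^g - 1\<close>. As \<open>g < e\<close>, \<open>lower\<close> makes \<open>r^2\<close>
    divide \<open>x^e - 1\<close>, which is squarefree.\<close>
  have no_common: "\<not> (r dvd cyclo e \<and> r dvd cyclo f)"
    if "prime_elem r" "e \<in> A" "f \<in> A" "gcd e f < e" for r e f
  proof
    assume r: "r dvd cyclo e \<and> r dvd cyclo f"
    have "r dvd monom 1 (gcd e f) - 1"
      using A(2)[OF that(2)] cyclo_dvd[OF that(2)] cyclo_dvd[OF that(3)] r
      by (intro monom_gcd_dvd[OF that(1)]) (auto intro: dvd_trans)
    then have "r * r dvd cyclo e * (monom 1 (gcd e f) - 1)" using r by (intro mult_dvd_mono) auto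
    then have "r * r dvd monom 1 e - 1" using lower[OF that(2) _ that(4)] dvd_trans by auto
    then show False using prime_elem_square_not_dvd[OF that(1)] A(2)[OF that(2)] by blast
  qed
  have "coprime (cyclo e) (cyclo f)" if ef: "e \<in> A" "f \<in> A" "e \<noteq> f" for e f
  proof (rule ccontr)
    assume nc: "\<not> coprime (cyclo e) (cyclo f)"
    have e0: "e > 0" "f > 0" using A ef by auto
    have nz: "cyclo e \<noteq> 0" using cyclo_dvd[OF ef(1)] monom_nz[OF e0(1)] by auto
    have "gcd (cyclo e) (cyclo f) \<noteq> 0" "\<not> is_unit (gcd (cyclo e) (cyclo f))"
      using nc nz by (auto simp: is_unit_gcd_iff)
    then obtain r where r: "prime r" "r dvd gcd (cyclo e) (cyclo f)"
      using prime_divisor_exists by blast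
    have "gcd e f \<le> e" "gcd f e \<le> f" by (auto intro!: dvd_imp_le e0)
    \<comment> \<open>Distinct \<open>e\<close> and \<open>f\<close> cannot both equal their gcd, so
      \<open>no_common\<close> applies in one of the two orders.\<close>
    then have "gcd e f < e \<or> gcd f e < f" using ef(3) unfolding gcd.commute[of f e] by linarith
    then show False using no_common[of r e f] no_common[of r f e] ef r by auto
  qed
  then have "(\<Prod>e\<in>A. cyclo e) dvd monom 1 n - 1"
    using cyclo_dvd_n A(1) by (intro prod_dvd_of_pairwise_coprime)
  then have "cyclo n * (\<Prod>e\<in>A. cyclo e) = monom 1 n - 1"
    using less.prems by (subst cyclo.simps) (simp add: A_def)
  moreover have "{e. e dvd n} = insert n A" using less.prems by (auto simp: A_def dest: dvd_imp_le intro: le_neq_implies_less)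
  ultimately show ?case using A(1) by (simp add: A_def)
qed

lemma cyclo_mult_dvd:
  assumes "e dvd n" "e < n"
  shows "cyclo n * (monom 1 e - 1) dvd monom 1 n - 1"
proof -
  have "e > 0" using assms by (auto intro: gr0I)
  then have "cyclo n * (monom 1 e - 1) = (\<Prod>i\<in>insert n {i. i dvd e}. cyclo i)"
    using prod_cyclo[of e] assms by (subst prod.insert) (auto dest: dvd_imp_le)
  also have "\<dots> dvd (\<Prod>i | i dvd n. cyclo i)"
    using assms by (intro prod_dvd_prod_subset) (auto intro: dvd_trans)
  finally show ?thesis using prod_cyclo[of n] assms by simp
qed

lemma pcompose_monom_square: "pcompose (monom 1 k) [:0, 0, 1:] = (monom 1 (2*k) :: rat poly)"
  by (induction k) (simp_all add: monom_Suc pcompose_pCons one_pCons[symmetric] pcompose_1)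

lemma cyclo_square_mult_dvd:
  assumes "e dvd n" "e < n"
  shows "pcompose (cyclo n) [:0, 0, 1:] * (monom 1 (2*e) - 1) dvd monom 1 (2*n) - 1"
proof -
  obtain c where "monom 1 n - 1 = cyclo n * (monom 1 e - 1) * c"
    using cyclo_mult_dvd[OF assms] by (elim dvdE)
  then have "pcompose (monom 1 n - 1) [:0, 0, 1:] = pcompose (cyclo n * (monom 1 e - 1) * c) [:0, 0, 1:]" by simp
  then have "monom 1 (2*n) - 1 = pcompose (cyclo n) [:0, 0, 1:] * (monom 1 (2*e) - 1) * pcompose c [:0, 0, 1:]"
    by (simp add: pcompose_diff pcompose_mult pcompose_monom_square pcompose_1)
  then show ?thesis by simp
qed

lemma qint2_poly_mult: "(monom 1 2 - 1) * qint2_poly n = monom 1 (2*n) - 1"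
proof -
  have "monom 1 (2*j) = (monom 1 2 :: rat poly) ^ j" for j by (simp add: monom_power mult.commute)
  then show ?thesis by (simp add: qint2_poly_def power_diff_1_eq)
qed

lemma cyclo_square_dvd_qint2_poly:
  assumes "n > 1"
  shows "pcompose (cyclo n) [:0, 0, 1:] dvd qint2_poly n"
proof -
  have "pcompose (cyclo n) [:0, 0, 1:] * (monom 1 2 - 1) dvd qint2_poly n * (monom 1 2 - 1)"
    using cyclo_square_mult_dvd[of 1 n] assms by (simp add: qint2_poly_mult mult.commute[of _ "monom 1 2 - 1"])
  then show ?thesis using monom_nz[of 2] by simp
qed

text \<open>If the order of \<open>x^2\<close> were 1, then \<open>qint2_poly n\<close> would be
  congruent to the nonzero constant \<open>n\<close>. If \<open>p\<close> divides the cyclotomic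
  factor and \<open>m < n\<close>, then \<open>p\<close> also divides \<open>x^(2m) - 1\<close>,
  which gives a double factor of \<open>x^(2n) - 1\<close>.\<close>

lemma prime_elem_order_square:
  fixes p :: "rat poly"
  assumes p: "prime_elem p" "p dvd qint2_poly n" and n: "n > 1"
  obtains m where "m > 1" "m dvd n" "\<And>j. p dvd monom 1 (2*j) - 1 \<longleftrightarrow> m dvd j"
    "p dvd pcompose (cyclo n) [:0, 0, 1:] \<Longrightarrow> m = n"
proof -
  let ?y = "monom 1 2 :: rat poly"
  have X: "monom 1 (2*j) = ?y ^ j" for j by (simp add: monom_power mult.commute)
  have pn: "p dvd monom 1 (2*n) - 1" using p(2) unfolding qint2_poly_mult[symmetric] by simp
  then obtain m where m: "m > 0" "\<And>j. p dvd monom 1 (2*j) - 1 \<longleftrightarrow> m dvd j"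
    using prime_elem_power_order[OF p(1), of n ?y] n unfolding X by auto
  have "\<not> p dvd ?y - 1"
  proof
    assume *: "p dvd ?y - 1"
    have "p dvd (\<Sum>j<n. monom 1 (2*j) - 1)"
      using * unfolding X by (intro dvd_sum) (auto simp: power_diff_1_eq)
    then have "p dvd qint2_poly n - (\<Sum>j<n. monom 1 (2*j) - 1)" using p(2) by simp
    then have "p dvd of_nat n" by (simp add: qint2_poly_def sum_subtractf)
    then show False using prime_elem_not_dvd_of_nat[OF p(1)] n by simp
  qed
  then have "m \<noteq> 1" using m(2)[of 1] by simp
  then have m1: "m > 1" using m(1) by simp
  have mn: "m dvd n" using pn m(2) by simp
  have "m = n" if C: "p dvd pcompose (cyclo n) [:0, 0, 1:]"
  proof (rule ccontr)
    assume "m \<noteq> n"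
    then have lt: "m < n" using mn n by (auto dest: dvd_imp_le)
    have "p * p dvd pcompose (cyclo n) [:0, 0, 1:] * (monom 1 (2*m) - 1)"
      using C m(2)[of m] by (intro mult_dvd_mono) auto
    then have "p * p dvd monom 1 (2*n) - 1" using cyclo_square_mult_dvd[OF mn lt] dvd_trans by blast
    then show False using prime_elem_square_not_dvd[OF p(1), of "2*n"] n by simp
  qed
  then show ?thesis using that m1 mn m(2) by blast
qed

section \<open>Localization at a prime polynomial and the passage from local to global\<close>

definition localization :: "'a::idom \<Rightarrow> 'a fract set" where
  "localization p = {x. \<exists>N D. \<not> p dvd D \<and> x = Fract N D}"

lemma localization_valuation_subring:
  assumes p: "prime_elem p"
  shows "valuation_subring (localization p) (Fract p 1)"
proof
  have p0: "p \<noteq> 0" and pu: "\<not> p dvd 1" using p by (auto simp: prime_elem_def)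
  have nz: "D \<noteq> 0" if "\<not> p dvd D" for D using that by auto
  have mult: "\<not> p dvd D * D'" if "\<not> p dvd D" "\<not> p dvd D'" for D D'
    using that prime_elem_dvd_mult_iff[OF p] by blast
  show "1 \<in> localization p" using pu by (auto simp: localization_def One_fract_def)
  show "x + y \<in> localization p" if "x \<in> localization p" "y \<in> localization p" for x y
    using that mult nz unfolding localization_def by (auto simp: add_fract) metis
  show "- x \<in> localization p" if "x \<in> localization p" for x
    using that by (auto simp: localization_def) blast
  show "x * y \<in> localization p" if "x \<in> localization p" "y \<in> localization p" for x y
    using that mult unfolding localization_def by (auto simp: mult_fract) metis
  show "Fract p 1 \<in> localization p" using pu by (auto simp: localization_def)
  show "Fract p 1 \<noteq> 0" using p0 by (simp add: Zero_fract_def eq_fract)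
  show "inverse (Fract p 1) \<notin> localization p"
    using p0 nz by (auto simp: localization_def eq_fract)
  show "x / Fract p 1 \<in> localization p" if x: "x \<in> localization p" "inverse x \<notin> localization p" for x
  proof -
    obtain N D where ND: "\<not> p dvd D" "x = Fract N D" using x(1) by (auto simp: localization_def)
    then have "inverse x = Fract D N" by simp
    then have "p dvd N" using x(2) by (auto simp: localization_def)
    then obtain M where "N = p * M" by (elim dvdE)
    then have "x / Fract p 1 = Fract M D" using ND nz p0 by (simp add: eq_fract)
    then show ?thesis using ND(1) by (auto simp: localization_def)
  qed
qed

lemma Fract_in_localization_iff:
  fixes p :: "rat poly"
  assumes p: "prime_elem p"
  shows "Fract N 1 / Fract p 1 ^ e \<in> localization p \<longleftrightarrow> p ^ e dvd N"
proof -
  have p0: "p \<noteq> 0" using p by (auto simp: prime_elem_def)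
  have pw: "Fract p 1 ^ e = Fract (p ^ e) 1" by (induction e) (auto simp: One_fract_def)
  show ?thesis
  proof
    assume "p ^ e dvd N"
    then obtain M where "N = p ^ e * M" by (elim dvdE)
    then have "Fract N 1 / Fract p 1 ^ e = Fract M 1" using p0 by (simp add: pw eq_fract)
    then show "Fract N 1 / Fract p 1 ^ e \<in> localization p"
      using p by (auto simp: localization_def prime_elem_def)
  next
    assume "Fract N 1 / Fract p 1 ^ e \<in> localization p"
    then obtain M D where MD: "\<not> p dvd D" "Fract N (p ^ e) = Fract M D" by (auto simp: localization_def pw)
    have "D \<noteq> 0" using MD(1) by auto
    then have "N * D = M * p ^ e" using p0 MD(2) by (simp add: eq_fract)
    then have "p ^ e dvd N * D" by simp
    then show "p ^ e dvd N" using prime_power_dvd_multD[OF p, of e D N] MD(1)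
      by (cases "e = 0") (auto simp: mult.commute)
  qed
qed

lemma qvar_power: "qvar ^ k = Fract (monom 1 k) 1"
  by (induction k) (simp_all add: qvar_def monom_Suc One_fract_def)

lemma one_minus_qvar_power: "1 - qvar powi (2 * int k) = Fract (- (monom 1 (2*k) - 1)) 1"
proof -
  have "qvar powi (2 * int k) = Fract (monom 1 (2*k)) 1"
    using power_int_of_nat[of qvar "2*k"] by (simp add: qvar_power)
  then show ?thesis by (simp add: One_fract_def)
qed

lemma qvar_nz: "qvar \<noteq> 0"
  by (simp add: qvar_def Zero_fract_def eq_fract)

text \<open>\<open>q\<close> is a unit because \<open>p\<close> divides \<open>q^(2n) - 1\<close>,
  and \<open>exact\<close> is the squarefreeness of \<open>x^(2k) - 1\<close>. Negative exponents
  are reduced to positive ones by \<open>neg\<close>, which splits off a unit.\<close>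

lemma localization_cyclotomic_subring:
  fixes p :: "rat poly"
  assumes p: "prime_elem p" "p dvd qint2_poly n" and n: "n > 1" and d: "d \<ge> 2" "coprime d (int n)"
  obtains m where "m > 1" "m dvd n" "p dvd pcompose (cyclo n) [:0, 0, 1:] \<Longrightarrow> m = n"
    "cyclotomic_subring (localization p) (Fract p 1) qvar d m"
proof -
  obtain m where m: "m > 1" "m dvd n" "\<And>j. p dvd monom 1 (2*j) - 1 \<longleftrightarrow> m dvd j"
    "p dvd pcompose (cyclo n) [:0, 0, 1:] \<Longrightarrow> m = n"
    using prime_elem_order_square[OF p n] by metis
  interpret valuation_subring "localization p" "Fract p 1"
    using localization_valuation_subring[OF p(1)] .
  have FI: "Fract N 1 \<in> I 1 \<longleftrightarrow> p dvd N" for N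
    using Fract_in_localization_iff[OF p(1), of N 1] by (simp add: I_def)
  have FR: "Fract N 1 \<in> localization p" for N
    using p(1) by (auto simp: localization_def prime_elem_def)
  have q: "unit qvar"
  proof -
    have "\<not> p dvd [:0, 1:]"
    proof
      assume "p dvd [:0, 1:]"
      then have "p dvd [:0, 1:] * monom 1 (2*n - 1)" by (rule dvd_mult2)
      also have "[:0, 1:] * monom 1 (2*n - 1) = (monom 1 (2*n) :: rat poly)"
        using n monom_Suc[of "1::rat" "2*n - 1"] by simp
      finally have "p dvd monom 1 (2*n)" .
      moreover have "p dvd monom 1 (2*n) - 1" using m(2,3) by simp
      ultimately have "p dvd monom 1 (2*n) - (monom 1 (2*n) - 1)" by (rule dvd_diff)
      then show False using p(1) by (simp add: prime_elem_def)
    qed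
    then show ?thesis using FI FR by (simp add: unit_iff qvar_def)
  qed
  have two: "unit 2"
  proof -
    have "(2 :: rat poly fract) = 1 + 1" by simp
    also have "\<dots> = Fract (of_nat 2) 1" unfolding One_fract_def by (simp add: add_fract)
    finally have "(2 :: rat poly fract) = Fract (of_nat 2) 1" .
    then show ?thesis using FI[of "of_nat 2"] FR numeral_R prime_elem_not_dvd_of_nat[OF p(1), of 2] by (simp add: unit_iff)
  qed
  have ordn: "1 - qvar powi (2 * int k) \<in> I 1 \<longleftrightarrow> m dvd k" for k
    unfolding one_minus_qvar_power FI using m(3)[of k] by (simp only: dvd_minus_iff)
  have neg: "1 - qvar powi (2 * - j) = - (qvar powi (2 * - j)) * (1 - qvar powi (2 * j))" for j
    using qvar_nz by (simp add: algebra_simps flip: power_int_add)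
  have pu: "unit (- (qvar powi j))" for j by (intro unit_minus unit_powi q)
  have ordneg: "1 - qvar powi (2 * - j) \<in> I 1 \<longleftrightarrow> 1 - qvar powi (2 * j) \<in> I 1" for j
    unfolding neg using pu[of "2 * - j"] I_prime I_multR(2)
    by (metis unit_R unit_iff I_R diff_R one_R unit_powi q)
  have exactn: "Fract p 1 / (1 - qvar powi (2 * int k)) \<in> localization p" if "m dvd k" "k > 0" for k
  proof -
    have "p dvd monom 1 (2*k) - 1" using m(3) that by simp
    then obtain c where c: "monom 1 (2*k) - 1 = p * c" by (elim dvdE)
    have pc: "\<not> p dvd c" using prime_elem_square_not_dvd[OF p(1), of "2*k"] that c by auto
    have p0: "p \<noteq> 0" "c \<noteq> 0" using p(1) pc by (auto simp: prime_elem_def)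
    have "Fract p 1 / (1 - qvar powi (2 * int k)) = Fract (-1) c"
      unfolding one_minus_qvar_power c using p0 by (simp add: eq_fract)
    then show ?thesis using pc by (auto simp: localization_def)
  qed
  have "cyclotomic_subring (localization p) (Fract p 1) qvar d m"
  proof
    show "unit qvar" by (fact q)
    show "unit 2" by (fact two)
    show "0 < m" using m by simp
    show "2 \<le> d" by (fact d)
    show "coprime d (int m)" using d(2) m(2) by (meson coprime_divisors dvd_refl of_nat_dvd_iff)
    show "1 - qvar powi (2 * j) \<in> I 1 \<longleftrightarrow> int m dvd j" for j
    proof (cases j rule: int_cases2)
      case (nonneg k)
      then show ?thesis using ordn[of k] by simp
    next
      case (nonpos k)
      then show ?thesis using ordn[of k] ordneg[of "int k"] by simp
    qed
    show "Fract p 1 / (1 - qvar powi (2 * j)) \<in> localization p" if "int m dvd j" "j \<noteq> 0" for j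
    proof (cases j rule: int_cases2)
      case (nonneg k)
      then show ?thesis using exactn[of k] that by simp
    next
      case (nonpos k)
      have "Fract p 1 / (1 - qvar powi (2 * int k)) / (- (qvar powi (2 * - int k))) \<in> localization p"
        by (rule divide_R[OF exactn pu]) (use that nonpos in auto)
      then show ?thesis unfolding nonpos neg by (simp add: mult.commute)
    qed
    show "j = 0" if "qvar powi j = 1" for j
    proof -
      have *: "k = 0" if "qvar ^ k = 1" for k
      proof -
        have "monom 1 k = (1 :: rat poly)" using that by (simp add: qvar_power One_fract_def eq_fract)
        then show "k = 0" using monom_nz[of k] by auto
      qed
      show ?thesis using that qvar_nz
        by (cases j rule: int_cases2) (auto simp: power_int_minus dest!: *)
    qed
  qed
  then show ?thesis using that m by blast
qed

text \<open>Write \<open>x = N/D\<close> in lowest terms. A prime factor of \<open>A * C^2\<close>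
  divides \<open>A\<close>, hence \<open>N\<close> by \<open>loc1\<close>, and so cannot divide
  \<open>D\<close>. As \<open>A\<close> is squarefree and \<open>C\<close> divides \<open>A\<close>,
  a prime occurs in \<open>A * C^2\<close> at most three times if it divides \<open>C\<close> and at
  most once otherwise.\<close>

lemma divisible_of_localizations:
  fixes A C :: "rat poly" and x :: "rat poly fract"
  assumes A0: "A \<noteq> 0" and CA: "C dvd A" and sqf: "\<And>p. prime p \<Longrightarrow> \<not> p * p dvd A"
    and loc1: "\<And>p. prime p \<Longrightarrow> p dvd A \<Longrightarrow> x / Fract p 1 \<in> localization p"
    and loc3: "\<And>p. prime p \<Longrightarrow> p dvd C \<Longrightarrow> x / Fract p 1 ^ 3 \<in> localization p"
  shows "\<exists>N D. D \<noteq> 0 \<and> coprime D (A * C\<^sup>2) \<and> x = Fract N D \<and> A * C\<^sup>2 dvd N"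
proof -
  obtain a b where ab: "x = Fract a b" "b \<noteq> 0" by (cases x rule: Fract_cases) auto
  have "gcd a b \<noteq> 0" using ab by simp
  then obtain N D where ND: "a = N * gcd a b" "b = D * gcd a b" "coprime N D"
    using gcd_coprime_exists by blast
  have D0: "D \<noteq> 0" using ND(2) ab(2) by auto
  have x: "x = Fract N D"
    using ab ND(1,2) D0 by (metis Fraction_Field.mult_fract_cancel mult.commute \<open>gcd a b \<noteq> 0\<close>)
  have C0: "C \<noteq> 0" using CA A0 by auto
  have power_dvd: "p ^ e dvd N" if p: "prime p" and loc: "x / Fract p 1 ^ e \<in> localization p" for p e
  proof -
    have p0: "p \<noteq> 0" "prime_elem p" using p by auto
    have pw: "Fract p 1 ^ e = Fract (p ^ e) 1" by (induction e) (auto simp: One_fract_def)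
    obtain M E where ME: "\<not> p dvd E" "x / Fract p 1 ^ e = Fract M E"
      using loc by (auto simp: localization_def)
    have E0: "E \<noteq> 0" using ME(1) by auto
    have "Fract N (D * p ^ e) = Fract M E" using ME(2) unfolding x pw by simp
    then have "N * E = M * (D * p ^ e)" using E0 D0 p0 by (simp add: eq_fract)
    then have "p ^ e dvd E * N" by (metis dvd_triv_right mult.assoc mult.commute)
    then show ?thesis using prime_power_dvd_multD[OF p0(2), of e E N] ME(1) by (cases "e = 0") auto
  qed
  have "coprime D (A * C\<^sup>2)"
  proof (rule ccontr)
    assume "\<not> coprime D (A * C\<^sup>2)"
    then have "\<not> is_unit (gcd D (A * C\<^sup>2))" by (simp only: is_unit_gcd not_False_eq_True)
    moreover have "gcd D (A * C\<^sup>2) \<noteq> 0" using D0 by simp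
    ultimately obtain r where r: "prime r" "r dvd gcd D (A * C\<^sup>2)"
      using prime_divisor_exists by blast
    then have "r dvd A * C\<^sup>2" by simp
    then have "r dvd A \<or> r dvd C" using r(1)
      by (metis prime_dvd_mult_iff prime_dvd_power)
    then have "r dvd A" using CA dvd_trans by blast
    then have "r dvd N" using power_dvd[OF r(1), of 1] loc1[OF r(1)] by simp
    then have "is_unit r" using ND(3) r(2) by (meson coprime_common_divisor dvd_trans gcd_dvd1)
    then show False using r(1) by auto
  qed
  moreover have "A * C\<^sup>2 dvd N"
  proof (cases "N = 0")
    case False
    show ?thesis
    proof (rule multiplicity_le_imp_dvd)
      show "A * C\<^sup>2 \<noteq> 0" using A0 C0 by simp
      fix p :: "rat poly" assume p: "prime p"
      then have pe: "prime_elem p" "\<not> is_unit p" by auto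
      have mult: "multiplicity p (A * C\<^sup>2) = multiplicity p A + 2 * multiplicity p C"
        using A0 C0 pe by (simp add: prime_elem_multiplicity_mult_distrib prime_elem_multiplicity_power_distrib)
      have mA: "multiplicity p A < 2"
        using A0 pe sqf[OF p] by (intro multiplicity_lessI) (auto simp: power2_eq_square)
      have mC: "multiplicity p C \<le> multiplicity p A" by (rule dvd_imp_multiplicity_le) (use A0 CA in auto)
      have ge: "e \<le> multiplicity p N" if "p ^ e dvd N" for e
        using False pe that by (intro multiplicity_geI) auto
      show "multiplicity p (A * C\<^sup>2) \<le> multiplicity p N"
      proof (cases "p dvd C")
        case True
        then show ?thesis using ge[OF power_dvd[OF p loc3[OF p]]] mult mA mC by linarith
      next
        case nC: False
        then have C: "multiplicity p C = 0" by (rule not_dvd_imp_multiplicity_0)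
        show ?thesis
        proof (cases "p dvd A")
          case True
          then have "1 \<le> multiplicity p N" using ge[of 1] power_dvd[OF p, of 1] loc1[OF p] by simp
          then show ?thesis using mult mA C by linarith
        next
          case False
          then have "multiplicity p A = 0" by (rule not_dvd_imp_multiplicity_0)
          then show ?thesis using mult C by simp
        qed
      qed
    qed
  qed simp
  ultimately show ?thesis using D0 x by blast
qed

section \<open>Assembling the two congruences\<close>

lemma qpoch_eq: "qpoch = qpochhammer"
  by (intro ext) (simp add: qpoch_def qpochhammer_def)

lemma summand_eq:
  "qint2 (2 * d * int k + t) * (qint (2 * d * int k + t))\<^sup>2 *
          (qpoch (qvar powi (2 * t)) (qvar powi (2 * d)) k)^4 /
          (qpoch (qvar powi (2 * d)) (qvar powi (2 * d)) k)^4 * qvar powi (- 4 * t * int k)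
   = wp_term (qvar powi t) (qvar powi (2*d)) k / ((1 - qvar\<^sup>2) * (1 - qvar)\<^sup>2)"
proof -
  have 1: "qvar powi (2 * (2 * d * int k + t)) = (qvar powi t)\<^sup>2 * ((qvar powi (2*d))^k)\<^sup>2"
    using qvar_nz by (simp add: power_int_power' algebra_simps flip: power_int_add)
  have 2: "qvar powi (2 * d * int k + t) = qvar powi t * (qvar powi (2*d))^k"
    using qvar_nz by (simp add: power_int_power' algebra_simps flip: power_int_add)
  have "(qvar powi t) ^ (4*k) = qvar powi (4 * t * int k)" by (simp add: power_int_power' mult_ac)
  then have 3: "qvar powi (- 4 * t * int k) = 1 / (qvar powi t) ^ (4*k)"
    by (simp add: power_int_minus divide_inverse)
  have 4: "qvar powi (2 * t) = (qvar powi t)\<^sup>2" by (simp add: power_int_power' mult.commute)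
  show ?thesis unfolding qint2_def qint_def qpoch_eq wp_term_def 1 2 3 unfolding 4
    by (simp add: power_divide)
qed

text \<open>\<open>K\<close> stands for either upper limit. At a prime factor of
  \<open>qint2_poly\<close>, one factor \<open>p\<close> comes from \<open>truncated_sum\<close> or
  \<open>full_blocks_sum\<close> and from \<open>rhs_I1\<close>; at a prime of the cyclotomic part,
  three come from \<open>cubic_congruence\<close>, with \<open>tail_terms\<close> for the longer
  sum.\<close>

lemma sum_congruence:
  fixes n t d :: int
  assumes n: "n > 1" and d: "d \<ge> 2" and cop: "coprime t d" and mod: "n mod d = t mod d"
    and K: "K = N \<or> K = nat n - 1" and N: "t + d * int N = n" "N < nat n"
  shows "qcong (\<Sum>k\<le>K. wp_term (qvar powi t) (qvar powi (2*d)) k / ((1 - qvar\<^sup>2) * (1 - qvar)\<^sup>2))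
     ((- 2 * (qint t)^2 * qint2 n * qpoch (qvar powi (4 * t)) (qvar powi (2 * d)) N) /
        ((1 + qvar powi (2 * t)) * qpoch (qvar powi (2 * d)) (qvar powi (2 * d)) N) *
        qvar powi (t - 2 * t * int N))
     (qint2_poly (nat n) * (pcompose (cyclo (nat n)) [:0, 0, 1:])^2)"
proof -
  define n' where "n' = nat n"
  have n': "n = int n'" "n' > 1" using n by (auto simp: n'_def)
  have "coprime n d" using cop mod by (metis coprime_mod_left_iff coprime_commute d not_numeral_le_zero)
  then have cop': "coprime d (int n')" by (simp add: n' coprime_commute)
  define RH where "RH = - 2 * (1 - qvar powi t)\<^sup>2 * (1 - qvar powi (2*n))
    * (qpochhammer (qvar powi (4*t)) (qvar powi (2*d)) N / ((1 + qvar powi (2*t)) * qpochhammer (qvar powi (2*d)) (qvar powi (2*d)) N))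
    * qvar powi (t - 2 * t * int N)"
  define S where "S = (\<Sum>k\<le>K. wp_term (qvar powi t) (qvar powi (2*d)) k)"
  define U where "U = (1 - qvar\<^sup>2) * (1 - qvar)\<^sup>2"
  have diff: "(\<Sum>k\<le>K. wp_term (qvar powi t) (qvar powi (2*d)) k / U)
    - (- 2 * (qint t)^2 * qint2 n * qpoch (qvar powi (4 * t)) (qvar powi (2 * d)) N) /
        ((1 + qvar powi (2 * t)) * qpoch (qvar powi (2 * d)) (qvar powi (2 * d)) N) *
        qvar powi (t - 2 * t * int N) = (S - RH) / U" (is "_ - ?r = _")
  proof -
    have "?r = RH / U"
      unfolding qint_def qint2_def RH_def U_def qpoch_eq by (simp add: power_divide mult_ac)
    then show ?thesis by (simp add: S_def sum_divide_distrib diff_divide_distrib)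
  qed
  have local: "(S - RH) / U / Fract p 1 \<in> localization p \<and>
      (p dvd pcompose (cyclo n') [:0, 0, 1:] \<longrightarrow> (S - RH) / U / Fract p 1 ^ 3 \<in> localization p)"
    if p: "prime p" "p dvd qint2_poly n'" for p
  proof -
    have pe: "prime_elem p" using p(1) by simp
    obtain m where m: "m > 1" "m dvd n'" "p dvd pcompose (cyclo n') [:0, 0, 1:] \<Longrightarrow> m = n'"
      "cyclotomic_subring (localization p) (Fract p 1) qvar d m"
      using localization_cyclotomic_subring[OF pe p(2) n'(2) d cop'] by metis
    interpret cyclotomic_subring "localization p" "Fract p 1" qvar d m by (fact m(4))
    have Q: "qvar powi (2*d) = Q" by (simp add: Q_def)
    have RH: "RH = rhs t N n" by (simp add: RH_def rhs_def Q)
    have S: "S = (\<Sum>k\<le>K. wp_term (qvar powi t) Q k)" by (simp add: S_def Q)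
    \<comment> \<open>\<open>m > 1\<close> means that \<open>p\<close> does not divide
      \<open>1 - q^2\<close>, and therefore not \<open>1 - q\<close>; so the scaling factor
      \<open>U\<close> does not affect divisibility by \<open>p\<close>.\<close>
    have U: "unit U"
    proof -
      have "unit (1 - qvar\<^sup>2)" using E_unit[of 1] m(1) by (simp add: E_def)
      moreover have "1 - qvar\<^sup>2 = (1 - qvar) * (1 + qvar)" by (simp add: power2_eq_square algebra_simps)
      moreover have "1 + qvar \<in> localization p" "1 - qvar \<in> localization p"
        using q_unit unit_R by (auto intro!: R_intros)
      ultimately have "unit (1 - qvar)" using I_multR(1) by (auto simp: unit_iff)
      then show ?thesis unfolding U_def using \<open>unit (1 - qvar\<^sup>2)\<close> by (intro unit_mult unit_power)
    qed
    have mn: "int m dvd n" using m(2) n' by simp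
    have S_block: "{..nat n - 1} = {..<n'}" using n' by auto
    have "S \<in> I 1"
    proof (cases "K = N")
      case True
      then show ?thesis unfolding S using truncated_sum[of t N] N(1) mn by simp
    next
      case False
      obtain l where "n' = m * l" using m(2) by (elim dvdE)
      then show ?thesis using False K full_blocks_sum[where l = l and t = t] unfolding S
        by (simp add: S_block mult.commute)
    qed
    moreover have "RH \<in> I 1" unfolding RH by (rule rhs_I1[OF N(1) mn])
    ultimately have "(S - RH) / U \<in> I 1" by (intro I_divide U I_diff)
    moreover have "(S - RH) / U \<in> I 3" if "p dvd pcompose (cyclo n') [:0, 0, 1:]"
    proof -
      have mm: "m = n'" using m(3) that .
      have tN: "t + d * int N = int m" "N < m" using N mm n' by auto
      have 1: "(\<Sum>k\<le>N. wp_term (qvar powi t) Q k) - RH \<in> I 3"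
        using cubic_congruence[OF tN] by (simp add: RH mm n')
      have "S - RH \<in> I 3"
      proof (cases "K = N")
        case False
        then have "S = (\<Sum>k<m. wp_term (qvar powi t) Q k)" using K unfolding S by (simp add: S_block mm)
        then show ?thesis using I_add[OF tail_terms[OF tN] 1] by simp
      qed (use 1 S in simp)
      then show ?thesis by (rule I_divide[OF _ U])
    qed
    ultimately show ?thesis by (simp add: I_def)
  qed
  have C: "pcompose (cyclo n') [:0, 0, 1:] dvd qint2_poly n'"
    by (rule cyclo_square_dvd_qint2_poly[OF n'(2)])
  have "\<exists>A D. D \<noteq> 0 \<and> coprime D (qint2_poly n' * (pcompose (cyclo n') [:0, 0, 1:])\<^sup>2)
      \<and> (S - RH) / U = Fract A D \<and> qint2_poly n' * (pcompose (cyclo n') [:0, 0, 1:])\<^sup>2 dvd A"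
  proof (rule divisible_of_localizations[OF _ C])
    show "qint2_poly n' \<noteq> 0" using qint2_poly_mult[of n'] monom_nz[of "2*n'"] n' by auto
    show "\<not> p * p dvd qint2_poly n'" if "prime p" for p
    proof
      assume "p * p dvd qint2_poly n'"
      then have "p * p dvd monom 1 (2*n') - 1" unfolding qint2_poly_mult[symmetric] by simp
      then show False using prime_elem_square_not_dvd[of p "2*n'"] that n' by auto
    qed
  qed (use local C dvd_trans in blast)+
  then show ?thesis unfolding qcong_def n'_def[symmetric] U_def[symmetric] diff by blast
qed

theorem theorem6:
  fixes n d t :: int
  assumes "n > 1" and "d \<ge> 2" and "gcd t d = 1" and "n mod d = t mod d"
    and "n + d - n * d \<le> t" and "t \<le> n"
  shows
    "qcong
       (\<Sum>k\<le>nat ((n - t) div d).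
          qint2 (2 * d * int k + t) * (qint (2 * d * int k + t))^2 *
          (qpoch (qvar powi (2 * t)) (qvar powi (2 * d)) k)^4 /
          (qpoch (qvar powi (2 * d)) (qvar powi (2 * d)) k)^4 *
          qvar powi (- 4 * t * int k))
       ((- 2 * (qint t)^2 * qint2 n *
           qpoch (qvar powi (4 * t)) (qvar powi (2 * d)) (nat ((n - t) div d))) /
        ((1 + qvar powi (2 * t)) *
           qpoch (qvar powi (2 * d)) (qvar powi (2 * d)) (nat ((n - t) div d))) *
        qvar powi (t - 2 * t * ((n - t) div d)))
       (qint2_poly (nat n) * (pcompose (cyclo (nat n)) [:0, 0, 1:])^2)
   \<and>
    qcong
       (\<Sum>k\<le>nat (n - 1).
          qint2 (2 * d * int k + t) * (qint (2 * d * int k + t))^2 *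
          (qpoch (qvar powi (2 * t)) (qvar powi (2 * d)) k)^4 /
          (qpoch (qvar powi (2 * d)) (qvar powi (2 * d)) k)^4 *
          qvar powi (- 4 * t * int k))
       ((- 2 * (qint t)^2 * qint2 n *
           qpoch (qvar powi (4 * t)) (qvar powi (2 * d)) (nat ((n - t) div d))) /
        ((1 + qvar powi (2 * t)) *
           qpoch (qvar powi (2 * d)) (qvar powi (2 * d)) (nat ((n - t) div d))) *
        qvar powi (t - 2 * t * ((n - t) div d)))
       (qint2_poly (nat n) * (pcompose (cyclo (nat n)) [:0, 0, 1:])^2)"
proof -
  define N where "N = nat ((n - t) div d)"
  have "d dvd n - t" using assms(4) by (simp add: mod_eq_dvd_iff)
  then obtain j where j: "n - t = d * j" by (elim dvdE)
  \<comment> \<open>The upper bound on \<open>t\<close> yields \<open>j \<ge> 0\<close> and the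
    lower bound \<open>j \<le> n - 1\<close>; hence \<open>N < n\<close>, so that the truncated sum
    stays within one block of length \<open>n\<close>.\<close>
  have "j \<ge> 0" using j assms(2,6) by (metis diff_ge_0_iff_ge zero_le_mult_iff not_numeral_le_zero order_trans)
  moreover have "d * j \<le> d * (n - 1)" using assms(5) j by (simp add: algebra_simps)
  then have "j \<le> n - 1" using assms(2) by simp
  moreover have "(n - t) div d = j" using j assms(2) by simp
  ultimately have N: "(n - t) div d = int N" "t + d * int N = n" "N < nat n"
    using j assms(1) by (auto simp: N_def)
  have cop: "coprime t d" using assms(3) by (simp add: coprime_iff_gcd_eq_1)
  have n1: "nat (n - 1) = nat n - 1" using assms(1) by simp
  show ?thesis
    unfolding summand_eq N(1) nat_int n1
    using sum_congruence[OF assms(1,2) cop assms(4) _ N(2,3)] by blast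
qed

end
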